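(* Let $d\in[1,+\infty]$ and let $G:\mathbb{D}\times[0,+\infty)\to\mathbb{C}$ be a Herglotz vector field of order $d$ in the unit disc $\mathbb{D}$. Then there exist a measurable function $\tau:[0,+\infty)\to\overline{\mathbb{D}}$ and a Herglotz function $p:\mathbb{D}\times[0,+\infty)\to\mathbb{C}$ of order $d$ such that for all $z\in\mathbb{D}$ $$G(z,t)=(z-\tau(t))(\overline{\tau(t)}z-1)p(z,t)\quad\text{for a.e. } t\in[0,+\infty).\qquad( * )$$ The pair is essentially unique: if $\tilde\tau:[0,+\infty)\to\overline{\mathbb{D}}$ is another measurable function and $\tilde p$ is another Herglotz function of order $d$ such that $( * )$ holds with $(\tilde\tau,\tilde p)$ in place of $(\tau,p)$, then $p(z,t)=\tilde p(z,t)$ for almost every $t\in[0,+\infty)$ and all $z\in\mathbb{D}$, and $\tau(t)=\tilde\tau(t)$ for almost all $t\in[0,+\infty)$ such that $G(\cdot,t)\not\equiv0$. Conversely, given a measurable function $\tau:[0,+\infty)\to\overline{\mathbb{D}}$ and a Herglotz function $p$ of order $d$, the formula $G(z,t)=(z-\tau(t))(\overline{\tau(t)}z-1)p(z,t)$, $z\in\mathbb{D}$, $t\ge0$, defines a Herglotz vector field of order $d$.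
   Context: $\mathbb{D}=\{\zeta\in\mathbb{C}:|\zeta|<1\}$. Infinitesimal generator: a semigroup of holomorphic self-maps of $\mathbb{D}$ is a family $(\phi_t)_{t\ge0}$ of holomorphic self-maps of $\mathbb{D}$ with $\phi_0=\mathrm{id}$, $\phi_{t+s}=\phi_t\circ\phi_s$, and $\phi_t\to\mathrm{id}$ uniformly on compact sets as $t\to0$; its infinitesimal generator is the unique holomorphic $F:\mathbb{D}\to\mathbb{C}$ with $\frac{\partial\phi_t(z)}{\partial t}=F(\phi_t(z))$ for all $z\in\mathbb{D}$, $t\ge0$. $\mathrm{Gen}(\mathbb{D})$ denotes the set of all such generators. Herglotz vector field: a weak holomorphic vector field of order $d$ on $\mathbb{D}$ is a function $G:\mathbb{D}\times[0,+\infty)\to\mathbb{C}$ such that $t\mapsto G(z,t)$ is measurable for every $z\in\mathbb{D}$, $z\mapsto G(z,t)$ is holomorphic for every $t\ge0$, and for every compact $K\subset\mathbb{D}$ and $T>0$ there is a non-negative $k_{K,T}\in L^d([0,T],\mathbb{R})$ with $|G(z,t)|\le k_{K,T}(t)$ for all $z\in K$ and a.e. $t\in[0,T]$. It is a Herglotz vector field of order $d$ if moreover $G(\cdot,t)\in\mathrm{Gen}(\mathbb{D})$ for almost every $t\in[0,+\infty)$. Herglotz function: a Herglotz function of order $d$ is a function $p:\mathbb{D}\times[0,+\infty)\to\mathbb{C}$ such that $t\mapsto p(z,t)$ belongs to $L^d_{loc}([0,+\infty),\mathbb{C})$ for every $z\in\mathbb{D}$, $z\mapsto p(z,t)$ is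 holomorphic for every $t\ge0$, and $\mathrm{Re}\,p(z,t)\ge0$ for all $z\in\mathbb{D}$, $t\ge0$. *)

theory Defs
  imports "HOL-Complex_Analysis.Complex_Analysis"
begin

abbreviation unit_disc :: "complex set" where
  "unit_disc \<equiv> ball 0 1"

definition holomorphic_semigroup :: "(real \<Rightarrow> complex \<Rightarrow> complex) \<Rightarrow> bool" where
  "holomorphic_semigroup \<phi> \<longleftrightarrow>
     (\<forall>t\<ge>0. \<phi> t holomorphic_on unit_disc \<and> \<phi> t \<in> unit_disc \<rightarrow> unit_disc) \<and>
     (\<forall>z\<in>unit_disc. \<phi> 0 z = z) \<and>
     (\<forall>t\<ge>0. \<forall>s\<ge>0. \<forall>z\<in>unit_disc. \<phi> (t + s) z = \<phi> t (\<phi> s z)) \<and>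
     (\<forall>K. compact K \<and> K \<subseteq> unit_disc \<longrightarrow> uniform_limit K \<phi> (\<lambda>z. z) (at 0 within {0..}))"

(* The values of F outside the disc are irrelevant; on the disc the equation at t = 0 determines F.
   At t = 0 the time derivative is one-sided. *)
definition infinitesimal_generator ::
    "(real \<Rightarrow> complex \<Rightarrow> complex) \<Rightarrow> (complex \<Rightarrow> complex) \<Rightarrow> bool" where
  "infinitesimal_generator \<phi> F \<longleftrightarrow>
     F holomorphic_on unit_disc \<and>
     (\<forall>z\<in>unit_disc. \<forall>t\<ge>0.
        ((\<lambda>s. \<phi> s z) has_vector_derivative F (\<phi> t z)) (at t within {0..}))"

definition Gen :: "(complex \<Rightarrow> complex) set" where
  "Gen = {F. \<exists>\<phi>. holomorphic_semigroup \<phi> \<and> infinitesimal_generator \<phi> F}"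

definition in_L :: "ennreal \<Rightarrow> real set \<Rightarrow> (real \<Rightarrow> 'a::real_normed_vector) \<Rightarrow> bool" where
  "in_L d I f \<longleftrightarrow>
     f \<in> borel_measurable (lebesgue_on I) \<and>
     (if d = \<infinity> then \<exists>C. AE t in lebesgue_on I. norm (f t) \<le> C
      else integrable (lebesgue_on I) (\<lambda>t. norm (f t) powr enn2real d))"

definition in_L_loc :: "ennreal \<Rightarrow> real set \<Rightarrow> (real \<Rightarrow> 'a::real_normed_vector) \<Rightarrow> bool" where
  "in_L_loc d I f \<longleftrightarrow> (\<forall>K. compact K \<and> K \<subseteq> I \<longrightarrow> in_L d K f)"

(* Functions on the product of the disc with [0,oo) are total curried functions, constrained only
   on that domain. *)
definition weak_holomorphic_vector_field ::
    "ennreal \<Rightarrow> (complex \<Rightarrow> real \<Rightarrow> complex) \<Rightarrow> bool" where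
  "weak_holomorphic_vector_field d G \<longleftrightarrow>
     (\<forall>z\<in>unit_disc. G z \<in> borel_measurable (lebesgue_on {0..})) \<and>
     (\<forall>t\<ge>0. (\<lambda>z. G z t) holomorphic_on unit_disc) \<and>
     (\<forall>K T. compact K \<and> K \<subseteq> unit_disc \<and> T > 0 \<longrightarrow>
        (\<exists>k :: real \<Rightarrow> real. in_L d {0..T} k \<and> (\<forall>t\<in>{0..T}. k t \<ge> 0) \<and>
           (\<forall>z\<in>K. AE t in lebesgue_on {0..T}. norm (G z t) \<le> k t)))"

definition herglotz_vector_field :: "ennreal \<Rightarrow> (complex \<Rightarrow> real \<Rightarrow> complex) \<Rightarrow> bool" where
  "herglotz_vector_field d G \<longleftrightarrow>
     weak_holomorphic_vector_field d G \<and>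
     (AE t in lebesgue_on {0..}. (\<lambda>z. G z t) \<in> Gen)"

definition herglotz_function :: "ennreal \<Rightarrow> (complex \<Rightarrow> real \<Rightarrow> complex) \<Rightarrow> bool" where
  "herglotz_function d p \<longleftrightarrow>
     (\<forall>z\<in>unit_disc. in_L_loc d {0..} (p z)) \<and>
     (\<forall>t\<ge>0. (\<lambda>z. p z t) holomorphic_on unit_disc) \<and>
     (\<forall>z\<in>unit_disc. \<forall>t\<ge>0. Re (p z t) \<ge> 0)"

definition measurable_to_closed_disc :: "(real \<Rightarrow> complex) \<Rightarrow> bool" where
  "measurable_to_closed_disc \<tau> \<longleftrightarrow>
     \<tau> \<in> borel_measurable (lebesgue_on {0..}) \<and> \<tau> \<in> {0..} \<rightarrow> cball 0 1"

definition berkson_porta ::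
    "(real \<Rightarrow> complex) \<Rightarrow> (complex \<Rightarrow> real \<Rightarrow> complex) \<Rightarrow> complex \<Rightarrow> real \<Rightarrow> complex" where
  "berkson_porta \<tau> p z t = (z - \<tau> t) * (cnj (\<tau> t) * z - 1) * p z t"

end

theory Submission
  imports Defs
begin

text \<open>For a holomorphic function \<open>F\<close> on the disc the following are equivalent, and this carries the
whole theorem:

  (1) \<open>F\<close> is the generator of a semigroup;

  (2) \<open>F\<close> is inward pointing: \<open>Re (cnj z * F z) \<le> Re (cnj z * F 0) * (1 - |z|^2)\<close>;

  (3) \<open>F z = (z - \<tau>) * (cnj \<tau> * z - 1) * p z\<close> with \<open>|\<tau>| \<le> 1\<close> and a holomorphic \<open>p\<close>
  with \<open>Re p \<ge> 0\<close>.

(1) implies (2). By the Schwarz-Pick lemma \<open>\<phi>\<^sub>t\<close> does not increase the pseudo-hyperbolic distance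
between \<open>0\<close> and \<open>z\<close>. At \<open>t = 0\<close> there is equality, so the derivative at \<open>t = 0\<close> has a sign,
and this sign is (2).

(2) and (3) are equivalent by the maximum principle. Condition (2) says that
\<open>F z = F 0 - cnj (F 0) * z^2 - z * q z\<close> with \<open>Re q \<ge> 0\<close>. On the unit circle
\<open>(z - \<tau>) * (cnj \<tau> * z - 1) = - z * |z - \<tau>|^2\<close> and \<open>Re (cnj z * (F 0 - cnj (F 0) * z^2)) = 0\<close>,
so there both \<open>Re p \<ge> 0\<close> and \<open>Re q \<ge> 0\<close> say that \<open>Re (cnj z * F z) \<le> 0\<close>. To have boundary
values, \<open>p\<close> or \<open>q\<close> is first dilated. From (3) to (2) this is all. From (2) to (3) one also
subtracts \<open>\<epsilon> * z\<close> from the field; it then has a zero in the disc, which serves as \<open>\<tau>\<close>, and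
compactness of the closed disc gives \<open>\<tau>\<close> for \<open>F\<close> itself in the limit. The limit is taken in the
division-free inequality \<open>Re (F z * cnj ((z - \<tau>) * (cnj \<tau> * z - 1))) \<ge> 0\<close>; a \<open>\<tau>\<close> that
satisfies it is called a Berkson-Porta point of \<open>F\<close> below.

(2) implies (1). Along a solution of \<open>x' = F x\<close>, (2) bounds \<open>1 - |x t|^2\<close> from below by a
decaying exponential, so that solutions exist for all times. Since
\<open>F a - F b = Q a b * (a - b)\<close> with a continuous \<open>Q\<close>, the difference of two solutions satisfies
a scalar linear equation and equals its initial value times the exponential of an integral.
Uniqueness, the semigroup law and the holomorphic dependence on the initial value follow from
this one formula.

For a time-dependent field, (3) is applied for almost every \<open>t\<close>. If \<open>F\<close> is not identically
zero, its Berkson-Porta point is unique. As the Berkson-Porta points are cut out by countably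
many closed conditions, the preimage of a closed set under \<open>t \<mapsto> \<tau> t\<close> is obtained by countable
set operations, so \<open>\<tau>\<close> is measurable. Finally, Harnack's inequality bounds \<open>p\<close> on compact sets
by its value at \<open>0\<close>, and that value is bounded by \<open>G\<close> on a fixed disc; so the two integrability
conditions are equivalent.\<close>

section \<open>Holomorphic functions with nonnegative real part\<close>

text \<open>The maximum modulus principle for \<open>exp (- f)\<close>, whose modulus is \<open>exp (- Re f)\<close>.\<close>

lemma Re_nonneg_on_disc_if_on_circle:
  assumes "f holomorphic_on unit_disc" "continuous_on (cball 0 1) f"
    and "\<And>z. norm z = 1 \<Longrightarrow> Re (f z) \<ge> 0" and "z \<in> unit_disc"
  shows "Re (f z) \<ge> 0"
proof -
  have "norm (exp (- f z)) \<le> 1"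
  proof (rule maximum_modulus_frontier[where S = unit_disc and f = "\<lambda>z. exp (- f z)"])
    show "(\<lambda>z. exp (- f z)) holomorphic_on interior unit_disc"
      using assms(1) by (auto intro!: holomorphic_intros)
    show "continuous_on (closure unit_disc) (\<lambda>z. exp (- f z))"
      using assms(2) by (auto intro!: continuous_intros)
    show "norm (exp (- f z)) \<le> 1" if "z \<in> frontier unit_disc" for z
      using that assms(3)[of z] by (simp add: norm_exp_eq_Re)
  qed (use assms in auto)
  then show ?thesis by (simp add: norm_exp_eq_Re)
qed

text \<open>A nonconstant holomorphic function is open, so its values cannot touch the boundary of the
half-plane from inside.\<close>

lemma constant_if_Re_nonneg_attains_0:
  assumes hol: "p holomorphic_on unit_disc" and pos: "\<And>z. z \<in> unit_disc \<Longrightarrow> Re (p z) \<ge> 0"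
    and z0: "z0 \<in> unit_disc" "Re (p z0) = 0" and z: "z \<in> unit_disc"
  shows "p z = p z0"
proof (rule ccontr)
  assume "p z \<noteq> p z0"
  then have "\<not> p constant_on unit_disc"
    using z z0(1) unfolding constant_on_def by metis
  then have "open (p ` unit_disc)"
    using open_mapping_thm[OF hol, of unit_disc] by auto
  then obtain e where e: "e > 0" "ball (p z0) e \<subseteq> p ` unit_disc"
    using z0(1) by (meson image_eqI open_contains_ball)
  have "p z0 - of_real (e/2) \<in> ball (p z0) e"
    using e(1) by (simp add: dist_norm)
  then have "p z0 - of_real (e/2) \<in> p ` unit_disc" by (rule subsetD[OF e(2)])
  then obtain w where w: "p z0 - of_real (e/2) = p w" "w \<in> unit_disc" by (rule imageE)
  show False using pos[OF w(2)] z0(2) e(1) unfolding w(1)[symmetric] by simp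
qed

text \<open>The Cayley transform \<open>(p - p 0) / (p + cnj (p 0))\<close> maps the disc into itself and fixes \<open>0\<close>;
the Schwarz lemma for it, solved for \<open>|p z|\<close>, is this form of Harnack's inequality. As
\<open>Re (p 0)\<close> may vanish, the argument is applied to \<open>p + e\<close> with \<open>e > 0\<close> tending to \<open>0\<close>.\<close>

lemma Harnack_norm_le:
  assumes hol: "p holomorphic_on unit_disc" and pos: "\<And>z. z \<in> unit_disc \<Longrightarrow> Re (p z) \<ge> 0"
    and z: "norm z \<le> r" "r < 1"
  shows "norm (p z) * (1 - r) \<le> (1 + r) * norm (p 0)"
proof -
  have r0: "r \<ge> 0" using z norm_ge_zero[of z] by linarith
  have *: "norm (p z + of_real e) * (1 - r) \<le> (1 + r) * norm (p 0 + of_real e)"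
    if "e > 0" for e :: real
  proof -
    define q where "q w = p w + of_real e" for w
    define c where "c = q 0"
    have cpos: "Re c > 0" unfolding c_def q_def using pos[of 0] \<open>e > 0\<close> by simp
    have qpos: "Re (q w) > 0" if "w \<in> unit_disc" for w
      unfolding q_def using pos[OF that] \<open>e > 0\<close> by simp
    have nz: "q w + cnj c \<noteq> 0" if "w \<in> unit_disc" for w
    proof
      assume "q w + cnj c = 0"
      then have "Re (q w + cnj c) = 0" by simp
      with qpos[OF that] cpos show False by simp
    qed
    define m where "m w = (q w - c) / (q w + cnj c)" for w
    have "norm (m z) \<le> norm z"
    proof (rule Schwarz_Lemma(1))
      have "q holomorphic_on unit_disc" unfolding q_def using hol by (intro holomorphic_intros)
      then show "m holomorphic_on unit_disc"
        unfolding m_def using nz by (intro holomorphic_intros) auto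
      show "m 0 = 0" by (simp add: m_def c_def)
      show "norm (m w) < 1" if "norm w < 1" for w
      proof -
        have w: "w \<in> unit_disc" using that by simp
        have "norm (q w - c)^2 < norm (q w + cnj c)^2"
        proof -
          have "0 < Re (q w) * Re c" using qpos[OF w] cpos by simp
          then show ?thesis unfolding cmod_power2 by (simp add: power2_eq_square algebra_simps)
        qed
        then have "norm (q w - c) < norm (q w + cnj c)"
          by (rule power_less_imp_less_base) simp
        then show ?thesis using nz[OF w] by (simp add: m_def norm_divide)
      qed
      show "norm z < 1" using z by simp
    qed
    also have "norm z \<le> r" by (rule z)
    finally have "norm (q z - c) \<le> r * norm (q z + cnj c)"
      using nz[of z] z by (simp add: m_def norm_divide divide_le_eq)
    also have "\<dots> \<le> r * (norm (q z) + norm c)"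
      using r0 norm_triangle_ineq[of "q z" "cnj c"] by (intro mult_left_mono) auto
    finally have "norm (q z) - norm c \<le> r * (norm (q z) + norm c)"
      using norm_triangle_ineq2[of "q z" c] by linarith
    then show ?thesis by (simp add: q_def c_def algebra_simps)
  qed
  have "((\<lambda>e. norm (p z + of_real e) * (1 - r)) \<longlongrightarrow> norm (p z + of_real 0) * (1 - r)) (at_right 0)"
    by (intro tendsto_intros)
  moreover have "((\<lambda>e. (1 + r) * norm (p 0 + of_real e)) \<longlongrightarrow> (1 + r) * norm (p 0 + of_real 0)) (at_right 0)"
    by (intro tendsto_intros)
  moreover have "eventually (\<lambda>e. norm (p z + of_real e) * (1 - r) \<le> (1 + r) * norm (p 0 + of_real e)) (at_right 0)"
    using * by (auto simp: eventually_at_right_less intro: eventually_at_rightI[of 0 1])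
  ultimately show ?thesis
    using tendsto_le[OF trivial_limit_at_right_real] by fastforce
qed

lemma compact_subset_disc:
  assumes "compact K" "K \<subseteq> unit_disc"
  obtains r where "0 \<le> r" "r < 1" "K \<subseteq> cball 0 r"
proof (cases "K = {}")
  case True
  then show ?thesis using that[of 0] by auto
next
  case False
  then obtain k where k: "k \<in> K" "\<And>w. w \<in> K \<Longrightarrow> norm w \<le> norm k"
    using continuous_attains_sup[of K norm] assms by (auto intro: continuous_intros)
  have "0 \<le> norm k" "norm k < 1" "K \<subseteq> cball 0 (norm k)" using k assms by auto
  then show ?thesis by (rule that)
qed

section \<open>Berkson-Porta points and inward pointing fields\<close>

definition bp_factor :: "complex \<Rightarrow> complex \<Rightarrow> complex" where
  "bp_factor \<tau> z = (z - \<tau>) * (cnj \<tau> * z - 1)"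

text \<open>The infinitesimal form of the Schwarz-Pick inequality between the points \<open>0\<close> and \<open>z\<close>.\<close>

definition inward_pointing :: "(complex \<Rightarrow> complex) \<Rightarrow> bool" where
  "inward_pointing F \<longleftrightarrow>
     (\<forall>z\<in>unit_disc. Re (cnj z * F z) \<le> Re (cnj z * F 0) * (1 - (norm z)\<^sup>2))"

text \<open>For a nonzero factor this says that \<open>F z / bp_factor \<tau> z\<close> has nonnegative real part. Without
the division the condition is continuous in \<open>\<tau>\<close> on the closed disc, also where \<open>\<tau> = z\<close>, and
thus survives limits and allows the measurability argument.\<close>

definition bp_point :: "(complex \<Rightarrow> complex) \<Rightarrow> complex \<Rightarrow> bool" where
  "bp_point F \<tau> \<longleftrightarrow> (\<forall>z\<in>unit_disc. Re (F z * cnj (bp_factor \<tau> z)) \<ge> 0)"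

lemma cnj_mult_minus_1_neq_0:
  assumes "norm \<tau> \<le> 1" "norm z < 1"
  shows "cnj \<tau> * z - 1 \<noteq> 0"
proof
  assume "cnj \<tau> * z - 1 = 0"
  then have "norm \<tau> * norm z = 1" by (metis complex_mod_cnj norm_mult norm_one right_minus_eq)
  moreover have "norm \<tau> * norm z \<le> 1 * norm z" using assms by (intro mult_right_mono) auto
  ultimately show False using assms by simp
qed

lemma bp_factor_eq_0_iff:
  assumes "norm \<tau> \<le> 1" "norm z < 1"
  shows "bp_factor \<tau> z = 0 \<longleftrightarrow> z = \<tau>"
  using cnj_mult_minus_1_neq_0[OF assms] by (simp add: bp_factor_def)

text \<open>On the circle \<open>cnj \<tau> * z - 1 = - z * cnj (z - \<tau>)\<close>. Hence for \<open>z \<noteq> \<tau>\<close> on the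
circle \<open>F z / bp_factor \<tau> z\<close> is a negative multiple of \<open>cnj z * F z\<close>: its real part tells whether
the field points into the disc.\<close>

lemma bp_factor_on_circle:
  assumes "norm z = 1"
  shows "bp_factor \<tau> z = - z * of_real ((norm (z - \<tau>))\<^sup>2)"
proof -
  have "z * cnj z = 1" using complex_norm_square[of z] assms by simp
  then have "cnj \<tau> * z - 1 = - z * cnj (z - \<tau>)" by (simp add: algebra_simps)
  then show ?thesis unfolding bp_factor_def complex_norm_square by (simp add: mult_ac)
qed

lemma norm_bp_factor_le:
  assumes "norm \<tau> \<le> 1" "norm z \<le> 1"
  shows "norm (bp_factor \<tau> z) \<le> 4"
proof -
  have 1: "norm (z - \<tau>) \<le> 2" using norm_triangle_ineq4[of z \<tau>] assms by linarith
  have "norm (cnj \<tau> * z) \<le> 1" using assms by (simp add: norm_mult mult_le_one)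
  then have 2: "norm (cnj \<tau> * z - 1) \<le> 2" using norm_triangle_ineq4[of "cnj \<tau> * z" 1] by simp
  have "norm (z - \<tau>) * norm (cnj \<tau> * z - 1) \<le> 2 * 2"
    by (rule mult_mono[OF 1 2]) auto
  then show ?thesis by (simp add: bp_factor_def norm_mult)
qed

lemma divided_difference_holomorphic:
  assumes "f holomorphic_on S" "open S" "f a = 0"
  obtains g where "g holomorphic_on S" "\<And>z. f z = (z - a) * g z" 
proof -
  define g where "g z = (if z = a then deriv f a else (f z - f a) / (z - a))" for z
  show ?thesis
  proof
    show "g holomorphic_on S" unfolding g_def by (rule pole_lemma_open[OF assms(1,2)])
    show "f z = (z - a) * g z" for z using assms(3) by (auto simp: g_def)
  qed
qed

lemma cball_subset_ball_inverse:
  assumes "0 < r" "r < 1"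
  shows "cball (0::complex) 1 \<subseteq> ball 0 (1 / r)"
proof -
  have "1 < 1 / r" using assms by simp
  then show ?thesis by (auto intro: le_less_trans)
qed

text \<open>For \<open>z \<noteq> 0\<close> the inequality for \<open>F\<close> is \<open>|z|^2 * Re (q z) \<ge> 0\<close>; the value at \<open>0\<close> follows by
continuity. Unlike \<open>F\<close>, the function \<open>q\<close> can be dilated without losing its sign.\<close>

lemma inward_pointing_decomposition:
  assumes hol: "F holomorphic_on unit_disc" and inw: "inward_pointing F"
  obtains q where "q holomorphic_on unit_disc" "\<And>z. z \<in> unit_disc \<Longrightarrow> Re (q z) \<ge> 0"
    "\<And>z. F z = F 0 - cnj (F 0) * z\<^sup>2 - z * q z"
proof -
  define f where "f z = F 0 - cnj (F 0) * z\<^sup>2 - F z" for z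
  have "f holomorphic_on unit_disc" unfolding f_def using hol by (intro holomorphic_intros)
  moreover have "f 0 = 0" by (simp add: f_def)
  ultimately obtain q where q: "q holomorphic_on unit_disc" "\<And>z. f z = (z - 0) * q z"
    using divided_difference_holomorphic[of f unit_disc 0] by auto
  have pos: "Re (q z) \<ge> 0" if "z \<in> unit_disc" "z \<noteq> 0" for z
  proof -
    have "Re (cnj z * f z) = (norm z)\<^sup>2 * Re (q z)"
    proof -
      have "cnj z * f z = of_real ((norm z)\<^sup>2) * q z"
        using q(2)[of z] by (simp add: complex_norm_square mult_ac del: of_real_power)
      then show ?thesis by simp
    qed
    moreover have "Re (cnj z * f z) = Re (cnj z * F 0) - (norm z)\<^sup>2 * Re (cnj z * F 0) - Re (cnj z * F z)"
    proof -
      have "cnj z * f z = cnj z * F 0 - of_real ((norm z)\<^sup>2) * (cnj (F 0) * z) - cnj z * F z"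
        unfolding complex_norm_square by (simp add: f_def power2_eq_square algebra_simps)
      from arg_cong[OF this, of Re] show ?thesis by (simp add: algebra_simps flip: of_real_power)
    qed
    moreover have "Re (cnj z * F z) \<le> Re (cnj z * F 0) * (1 - (norm z)\<^sup>2)"
      using inw that(1) unfolding inward_pointing_def by blast
    ultimately have "(norm z)\<^sup>2 * Re (q z) \<ge> 0" by (simp add: algebra_simps)
    then show ?thesis using that(2) by (simp add: zero_le_mult_iff)
  qed
  have "Re (q 0) \<ge> 0"
  proof -
    have "continuous_on unit_disc q" by (rule holomorphic_on_imp_continuous_on[OF q(1)])
    then have "(q \<longlongrightarrow> q 0) (at 0)"
      by (simp add: continuous_on_eq_continuous_at continuous_at)
    then have "((\<lambda>z. Re (q z)) \<longlongrightarrow> Re (q 0)) (at 0)" by (rule tendsto_Re)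
    moreover have "eventually (\<lambda>z. Re (q z) \<ge> 0) (at 0)"
      unfolding eventually_at using pos by (intro exI[of _ 1]) auto
    ultimately show ?thesis by (rule tendsto_lowerbound) auto
  qed
  then have "Re (q z) \<ge> 0" if "z \<in> unit_disc" for z
    using pos that by (cases "z = 0") auto
  then show ?thesis using that[of q] q by (simp add: f_def algebra_simps)
qed

section \<open>Inward pointing fields have a Berkson-Porta factorization\<close>

text \<open>Without a zero, \<open>- z / f z\<close> would be holomorphic with nonnegative real part on the circle, hence
in the disc. But it vanishes at \<open>0\<close>, so it would be constantly \<open>0\<close>.\<close>

lemma zero_in_disc_if_strictly_inward:
  assumes hol: "f holomorphic_on unit_disc" and cont: "continuous_on (cball 0 1) f"
    and inw: "\<And>z. norm z = 1 \<Longrightarrow> Re (cnj z * f z) < 0"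
  shows "\<exists>\<tau>\<in>unit_disc. f \<tau> = 0"
proof (rule ccontr)
  assume "\<not> ?thesis"
  then have nz: "f z \<noteq> 0" if "z \<in> cball 0 1" for z
    using inw[of z] that by (cases "norm z = 1") auto
  define e where "e z = - (z / f z)" for z
  have "continuous_on (cball 0 1) e"
    unfolding e_def using cont nz by (intro continuous_intros) auto
  have hole: "e holomorphic_on unit_disc"
    unfolding e_def using hol nz by (intro holomorphic_intros) auto
  have pos: "Re (e z) \<ge> 0" if "z \<in> unit_disc" for z
  proof (rule Re_nonneg_on_disc_if_on_circle[OF hole _ _ that])
    show "Re (e z) \<ge> 0" if "norm z = 1" for z
    proof -
      have "e z = - (z * cnj (f z)) / of_real ((norm (f z))\<^sup>2)"
        unfolding e_def by (subst complex_div_cnj) simp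
      then have "Re (e z) = - Re (cnj z * f z) / (norm (f z))\<^sup>2"
        by (simp add: algebra_simps add_divide_distrib diff_divide_distrib Re_divide_of_real flip: of_real_power)
      then show ?thesis using inw[OF that] by (simp add: divide_nonneg_nonneg)
    qed
  qed fact
  have "e (1/2) = e 0"
    by (rule constant_if_Re_nonneg_attains_0[OF hole pos]) (auto simp: e_def)
  then show False using nz[of "1/2"] by (simp add: e_def)
qed

lemma factorization_imp_bp_point:
  assumes "\<And>z. z \<in> unit_disc \<Longrightarrow> Re (p z) \<ge> 0"
    and "\<And>z. z \<in> unit_disc \<Longrightarrow> F z = bp_factor \<tau> z * p z"
  shows "bp_point F \<tau>"
  unfolding bp_point_def
proof
  fix z :: complex assume z: "z \<in> unit_disc"
  have "F z * cnj (bp_factor \<tau> z) = of_real ((norm (bp_factor \<tau> z))\<^sup>2) * p z"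
    using assms(2)[OF z] by (simp add: complex_norm_square mult_ac del: of_real_power)
  then show "Re (F z * cnj (bp_factor \<tau> z)) \<ge> 0"
    using assms(1)[OF z] by (simp flip: of_real_power)
qed

text \<open>With boundary values available, the zero \<open>\<tau>\<close> of \<open>F\<close> does it: \<open>p = F / bp_factor \<tau>\<close> is
holomorphic across the circle, where its real part is
\<open>- Re (cnj z * F z) / |z - \<tau>|^2 > 0\<close>.\<close>

lemma bp_point_exists_if_strictly_inward:
  assumes hol: "F holomorphic_on S" "open S" "cball 0 1 \<subseteq> S"
    and inw: "\<And>z. norm z = 1 \<Longrightarrow> Re (cnj z * F z) < 0"
  shows "\<exists>\<tau>\<in>unit_disc. bp_point F \<tau>"
proof -
  have sub: "unit_disc \<subseteq> S" using hol(3) by auto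
  obtain \<tau> where \<tau>: "\<tau> \<in> unit_disc" "F \<tau> = 0"
    using zero_in_disc_if_strictly_inward[of F] inw hol
    by (meson holomorphic_on_imp_continuous_on holomorphic_on_subset sub)
  obtain g where g: "g holomorphic_on S" "\<And>z. F z = (z - \<tau>) * g z"
    using divided_difference_holomorphic[OF hol(1,2) \<tau>(2)] by blast
  define p where "p z = g z / (cnj \<tau> * z - 1)" for z
  have nz: "cnj \<tau> * z - 1 \<noteq> 0" if "norm z \<le> 1" for z
    using cnj_mult_minus_1_neq_0[of "cnj z" "cnj \<tau>"] that \<tau>(1) by (simp add: mult.commute)
  have F: "F z = bp_factor \<tau> z * p z" if "norm z \<le> 1" for z
    using nz[OF that] by (simp add: g(2) p_def bp_factor_def)
  have "Re (p z) \<ge> 0" if z: "z \<in> unit_disc" for z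
  proof (rule Re_nonneg_on_disc_if_on_circle[OF _ _ _ z])
    show "p holomorphic_on unit_disc"
      unfolding p_def using nz holomorphic_on_subset[OF g(1) sub] by (intro holomorphic_intros) auto
    show "continuous_on (cball 0 1) p"
      unfolding p_def using nz continuous_on_subset[OF holomorphic_on_imp_continuous_on[OF g(1)] hol(3)]
      by (intro continuous_intros) auto
    show "Re (p z) \<ge> 0" if z: "norm z = 1" for z
    proof -
      have "z * cnj z = 1" using complex_norm_square[of z] z by simp
      then have "cnj z * F z = - of_real ((norm (z - \<tau>))\<^sup>2) * p z"
        using F[of z] z by (simp add: bp_factor_on_circle mult_ac del: of_real_power)
      then have "Re (cnj z * F z) = - (norm (z - \<tau>))\<^sup>2 * Re (p z)"
        by (simp flip: of_real_power)
      then have "(norm (z - \<tau>))\<^sup>2 * Re (p z) > 0" using inw[OF z] by simp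
      then show ?thesis by (simp add: zero_less_mult_iff)
    qed
  qed
  then have "bp_point F \<tau>"
    by (rule factorization_imp_bp_point) (use F in auto)
  then show ?thesis using \<tau>(1) by blast
qed

text \<open>The fields \<open>G n\<close>, built from the dilation of \<open>q\<close> by \<open>r n\<close> and with the dissipative term
\<open>(1 - r n) * z\<close> subtracted, are holomorphic across the circle and strictly inward on it. They
converge to \<open>F\<close> pointwise, and a limit point of their Berkson-Porta points is one for \<open>F\<close>.\<close>

lemma bp_point_exists:
  assumes hol: "F holomorphic_on unit_disc" and inw: "inward_pointing F"
  shows "\<exists>\<tau>\<in>cball 0 1. bp_point F \<tau>"
proof -
  obtain q where q: "q holomorphic_on unit_disc" "\<And>z. z \<in> unit_disc \<Longrightarrow> Re (q z) \<ge> 0"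
    "\<And>z. F z = F 0 - cnj (F 0) * z\<^sup>2 - z * q z"
    using inward_pointing_decomposition[OF assms] by blast
  \<comment> \<open>The shift by 2 keeps \<open>r 0\<close> positive.\<close>
  define r :: "nat \<Rightarrow> real" where "r n = 1 - 1 / of_nat (n + 2)" for n
  have r: "0 < r n" "r n < 1" for n by (auto simp: r_def field_simps)
  define G where "G n z = F 0 - cnj (F 0) * z\<^sup>2 - z * (q (of_real (r n) * z) + of_real (1 - r n))" for n z
  have "\<exists>\<tau>\<in>unit_disc. bp_point (G n) \<tau>" for n
  proof (rule bp_point_exists_if_strictly_inward)
    show "open (ball (0::complex) (1 / r n))" "cball (0::complex) 1 \<subseteq> ball 0 (1 / r n)"
      using cball_subset_ball_inverse r by auto
    have m: "(\<lambda>z. of_real (r n) * z) ` ball 0 (1 / r n) \<subseteq> unit_disc"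
      using r[of n] by (auto simp: norm_mult field_simps)
    have "(q \<circ> (\<lambda>z. of_real (r n) * z)) holomorphic_on ball 0 (1 / r n)"
      by (rule holomorphic_on_compose_gen[OF _ q(1)]) (use m in \<open>auto intro!: holomorphic_intros\<close>)
    then show "G n holomorphic_on ball 0 (1 / r n)"
      unfolding G_def by (auto intro!: holomorphic_intros simp: o_def)
    show "Re (cnj z * G n z) < 0" if z: "norm z = 1" for z
    proof -
      have "z * cnj z = 1" using complex_norm_square[of z] z by simp
      moreover have zw: "z * (cnj z * w) = w" for w using \<open>z * cnj z = 1\<close> by (metis mult.assoc mult_1)
      ultimately have "cnj z * G n z = cnj z * F 0 - cnj (F 0) * z - (q (of_real (r n) * z) + of_real (1 - r n))"
        by (simp add: G_def zw power2_eq_square algebra_simps)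
      moreover have "norm (of_real (r n) * z) < 1" using r[of n] z by (simp add: norm_mult)
      ultimately show ?thesis using q(2)[of "of_real (r n) * z"] r[of n] by simp
    qed
  qed
  then obtain s where s: "\<And>n. s n \<in> unit_disc" "\<And>n. bp_point (G n) (s n)" by metis
  have "\<forall>n. s n \<in> cball 0 1" using s(1) by (auto simp: less_imp_le)
  then obtain \<tau> \<rho> where \<tau>: "\<tau> \<in> cball 0 1" "strict_mono (\<rho> :: nat \<Rightarrow> nat)" "(s \<circ> \<rho>) \<longlonglongrightarrow> \<tau>"
    using compact_cball[of "0::complex" 1] unfolding compact_eq_seq_compact_metric seq_compact_def by metis
  have "r \<longlonglongrightarrow> 1"
    unfolding r_def by real_asymp
  have "bp_point F \<tau>"
    unfolding bp_point_def
  proof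
    fix z :: complex assume z: "z \<in> unit_disc"
    have "(\<lambda>n. of_real (r n) * z) \<longlonglongrightarrow> of_real 1 * z"
      by (intro tendsto_intros \<open>r \<longlonglongrightarrow> 1\<close>)
    moreover have "isCont q z" using q(1) z holomorphic_on_imp_continuous_on
      by (metis continuous_on_eq_continuous_at open_ball)
    ultimately have "(\<lambda>n. q (of_real (r n) * z)) \<longlonglongrightarrow> q z"
      using isCont_tendsto_compose[of z q "\<lambda>n. of_real (r n) * z"] by simp
    then have "(\<lambda>n. G n z) \<longlonglongrightarrow> F 0 - cnj (F 0) * z\<^sup>2 - z * (q z + of_real (1 - 1))"
      unfolding G_def by (intro tendsto_intros \<open>r \<longlonglongrightarrow> 1\<close>)
    then have G: "(\<lambda>n. G n z) \<longlonglongrightarrow> F z" using q(3)[of z] by simp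
    have "(\<lambda>n. G (\<rho> n) z * cnj (bp_factor ((s \<circ> \<rho>) n) z)) \<longlonglongrightarrow> F z * cnj (bp_factor \<tau> z)"
      unfolding bp_factor_def
      by (intro tendsto_intros \<tau>(3) LIMSEQ_subseq_LIMSEQ[OF G \<tau>(2), unfolded o_def])
    then have "(\<lambda>n. Re (G (\<rho> n) z * cnj (bp_factor ((s \<circ> \<rho>) n) z))) \<longlonglongrightarrow> Re (F z * cnj (bp_factor \<tau> z))"
      by (rule tendsto_Re)
    then show "Re (F z * cnj (bp_factor \<tau> z)) \<ge> 0"
      by (rule LIMSEQ_le_const) (use s(2) z in \<open>auto simp: bp_point_def\<close>)
  qed
  then show ?thesis using \<tau>(1) by blast
qed

text \<open>Near an interior \<open>\<tau>\<close> the factor behaves like \<open>(z - \<tau>) * (|\<tau>|^2 - 1)\<close>. Approaching \<open>\<tau>\<close> in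
the direction \<open>F \<tau>\<close> gives \<open>|F \<tau>|^2 * (|\<tau>|^2 - 1) \<ge> 0\<close> in the limit.\<close>

lemma bp_point_zero:
  assumes hol: "F holomorphic_on unit_disc" and bp: "bp_point F \<tau>" and \<tau>: "\<tau> \<in> unit_disc"
  shows "F \<tau> = 0"
proof (rule ccontr)
  assume nz: "F \<tau> \<noteq> 0"
  \<comment> \<open>\<open>h s\<close> is \<open>F z * cnj (bp_factor \<tau> z)\<close> at \<open>z = \<tau> + s * F \<tau>\<close>, divided by \<open>s\<close>.\<close>
  define h where "h s = F (\<tau> + of_real s * F \<tau>) * cnj (F \<tau> * (cnj \<tau> * (\<tau> + of_real s * F \<tau>) - 1))" for s :: real
  have "isCont F \<tau>"
    using hol \<tau> holomorphic_on_imp_continuous_on by (metis continuous_on_eq_continuous_at open_ball)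
  have line: "((\<lambda>s. \<tau> + of_real s * F \<tau>) \<longlongrightarrow> \<tau> + of_real 0 * F \<tau>) (at_right (0::real))"
    by (intro tendsto_intros)
  then have "((\<lambda>s. F (\<tau> + of_real s * F \<tau>)) \<longlongrightarrow> F \<tau>) (at_right (0::real))"
    using isCont_tendsto_compose[OF \<open>isCont F \<tau>\<close>] by simp
  then have "(h \<longlongrightarrow> F \<tau> * cnj (F \<tau> * (cnj \<tau> * (\<tau> + of_real 0 * F \<tau>) - 1))) (at_right 0)"
    unfolding h_def by (intro tendsto_intros line)
  moreover have "F \<tau> * cnj (F \<tau> * (cnj \<tau> * (\<tau> + of_real 0 * F \<tau>) - 1)) = of_real ((norm (F \<tau>))\<^sup>2 * ((norm \<tau>)\<^sup>2 - 1))"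
    unfolding of_real_mult of_real_diff complex_norm_square by (simp add: algebra_simps)
  ultimately have "(h \<longlongrightarrow> of_real ((norm (F \<tau>))\<^sup>2 * ((norm \<tau>)\<^sup>2 - 1))) (at_right 0)" by simp
  then have lim: "((\<lambda>s. Re (h s)) \<longlongrightarrow> (norm (F \<tau>))\<^sup>2 * ((norm \<tau>)\<^sup>2 - 1)) (at_right 0)"
    using tendsto_Re by force
  have "eventually (\<lambda>s. \<tau> + of_real s * F \<tau> \<in> unit_disc) (at_right (0::real))"
    using topological_tendstoD[OF line, of unit_disc] \<tau> by simp
  moreover have "eventually (\<lambda>s::real. s > 0) (at_right 0)" by (rule eventually_at_right_less)
  ultimately have "eventually (\<lambda>s. Re (h s) \<ge> 0) (at_right 0)"
  proof eventually_elim
    case (elim s)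
    have "F (\<tau> + of_real s * F \<tau>) * cnj (bp_factor \<tau> (\<tau> + of_real s * F \<tau>)) = of_real s * h s"
      by (simp add: bp_factor_def h_def mult_ac)
    then have "s * Re (h s) \<ge> 0"
      using bp elim(1) unfolding bp_point_def by fastforce
    then show ?case using elim(2) by (simp add: zero_le_mult_iff)
  qed
  then have "(norm (F \<tau>))\<^sup>2 * ((norm \<tau>)\<^sup>2 - 1) \<ge> 0"
    using tendsto_lowerbound[OF lim] by simp
  moreover have "(norm \<tau>)\<^sup>2 < 1" using \<tau> by (simp add: power_less_one_iff)
  ultimately show False using nz by (simp add: zero_le_mult_iff)
qed

text \<open>The only possible zero of the factor in the disc is \<open>\<tau>\<close>, where \<open>F\<close> vanishes too; so the
quotient extends holomorphically, and the sign at \<open>\<tau>\<close> follows by continuity.\<close>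

lemma bp_point_imp_factorization:
  assumes hol: "F holomorphic_on unit_disc" and bp: "bp_point F \<tau>" and \<tau>: "\<tau> \<in> cball 0 1"
  obtains p where "p holomorphic_on unit_disc" "\<And>z. z \<in> unit_disc \<Longrightarrow> Re (p z) \<ge> 0"
    "\<And>z. z \<in> unit_disc \<Longrightarrow> F z = bp_factor \<tau> z * p z"
proof -
  obtain g where g: "g holomorphic_on unit_disc" "\<And>z. z \<in> unit_disc \<Longrightarrow> F z = (z - \<tau>) * g z"
  proof (cases "\<tau> \<in> unit_disc")
    case True
    then show ?thesis
      using divided_difference_holomorphic[OF hol open_ball bp_point_zero[OF hol bp True]] that by metis
  next
    case False
    show ?thesis
      by (rule that[of "\<lambda>z. F z / (z - \<tau>)"]) (use False hol in \<open>auto intro!: holomorphic_intros\<close>)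
  qed
  define p where "p z = g z / (cnj \<tau> * z - 1)" for z
  have nz: "cnj \<tau> * z - 1 \<noteq> 0" if "z \<in> unit_disc" for z
    using cnj_mult_minus_1_neq_0[of \<tau> z] that \<tau> by simp
  have holp: "p holomorphic_on unit_disc"
    unfolding p_def using nz g(1) by (intro holomorphic_intros) auto
  have F: "F z = bp_factor \<tau> z * p z" if "z \<in> unit_disc" for z
    using nz[OF that] g(2)[OF that] by (simp add: p_def bp_factor_def)
  have off: "Re (p z) \<ge> 0" if "z \<in> unit_disc" "z \<noteq> \<tau>" for z
  proof -
    have "F z * cnj (bp_factor \<tau> z) = of_real ((norm (bp_factor \<tau> z))\<^sup>2) * p z"
      using F[OF that(1)] by (simp add: complex_norm_square mult_ac del: of_real_power)
    then have "(norm (bp_factor \<tau> z))\<^sup>2 * Re (p z) \<ge> 0"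
      using bp that(1) unfolding bp_point_def by (fastforce simp flip: of_real_power)
    moreover have "bp_factor \<tau> z \<noteq> 0" using bp_factor_eq_0_iff[of \<tau> z] that \<tau> by simp
    ultimately show ?thesis by (simp add: zero_le_mult_iff)
  qed
  have "Re (p \<tau>) \<ge> 0" if "\<tau> \<in> unit_disc"
  proof -
    have "isCont p \<tau>" using that holp holomorphic_on_imp_continuous_on
      by (metis continuous_on_eq_continuous_at open_ball)
    then have "((\<lambda>z. Re (p z)) \<longlongrightarrow> Re (p \<tau>)) (at \<tau>)"
      unfolding isCont_def by (rule tendsto_Re)
    moreover have "eventually (\<lambda>z. z \<in> unit_disc - {\<tau>}) (at \<tau>)"
      using that by (intro eventually_at_in_open) auto
    then have "eventually (\<lambda>z. Re (p z) \<ge> 0) (at \<tau>)"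
      by eventually_elim (use off in auto)
    ultimately show ?thesis by (rule tendsto_lowerbound) auto
  qed
  then show ?thesis using that[OF holp _ F] off by blast
qed

section \<open>Berkson-Porta factorizations are inward pointing\<close>

text \<open>For the dilation \<open>p (r * z)\<close> the field \<open>H = bp_factor \<tau> * p (r * _)\<close> is holomorphic across the
circle, and there \<open>q z = cnj z * (H 0 - cnj (H 0) * z^2 - H z)\<close> has real part
\<open>|z - \<tau>|^2 * Re (p (r * z)) \<ge> 0\<close>. The maximum principle for \<open>q\<close> gives the inequality for \<open>H\<close>,
and \<open>r\<close> tends to \<open>1\<close>.\<close>

lemma factorization_imp_inward_pointing:
  assumes hol: "p holomorphic_on unit_disc" and pos: "\<And>z. z \<in> unit_disc \<Longrightarrow> Re (p z) \<ge> 0"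
    and F: "\<And>z. z \<in> unit_disc \<Longrightarrow> F z = bp_factor \<tau> z * p z"
  shows "inward_pointing F"
proof -
  have dil: "Re (cnj z * (bp_factor \<tau> z * p (of_real r * z)))
      \<le> Re (cnj z * (bp_factor \<tau> 0 * p 0)) * (1 - (norm z)\<^sup>2)"
    if z: "z \<in> unit_disc" and r: "0 < r" "r < 1" for z and r :: real
  proof -
    define H where "H z = bp_factor \<tau> z * p (of_real r * z)" for z
    define S where "S = ball (0::complex) (1/r)"
    have S: "open S" "cball 0 1 \<subseteq> S" "unit_disc \<subseteq> S"
      using cball_subset_ball_inverse[OF r] by (auto simp: S_def)
    have m: "(\<lambda>z. of_real r * z) ` S \<subseteq> unit_disc"
      using r by (auto simp: norm_mult field_simps S_def)
    have "(p \<circ> (\<lambda>z. of_real r * z)) holomorphic_on S"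
      by (rule holomorphic_on_compose_gen[OF _ hol]) (use m in \<open>auto intro!: holomorphic_intros\<close>)
    then have holH: "H holomorphic_on S"
      unfolding H_def bp_factor_def by (auto intro!: holomorphic_intros simp: o_def)
    define f where "f z = H 0 - cnj (H 0) * z\<^sup>2 - H z" for z
    have "f holomorphic_on S" unfolding f_def using holH by (intro holomorphic_intros)
    moreover have "f 0 = 0" by (simp add: f_def)
    ultimately obtain q where q: "q holomorphic_on S" "\<And>z. f z = (z - 0) * q z"
      using divided_difference_holomorphic[of f S 0] S(1) by auto
    have "Re (q z) \<ge> 0"
    proof (rule Re_nonneg_on_disc_if_on_circle[OF _ _ _ z])
      show "q holomorphic_on unit_disc" by (rule holomorphic_on_subset[OF q(1) S(3)])
      show "continuous_on (cball 0 1) q"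
        by (rule continuous_on_subset[OF holomorphic_on_imp_continuous_on[OF q(1)] S(2)])
      show "Re (q z) \<ge> 0" if z: "norm z = 1" for z
      proof -
        have zz: "z * cnj z = 1" using complex_norm_square[of z] z by simp
        have "cnj z * f z = q z" using q(2)[of z] zz by (simp add: mult_ac)
        moreover have "cnj z * f z = cnj z * H 0 - cnj (H 0) * z + of_real ((norm (z - \<tau>))\<^sup>2) * p (of_real r * z)"
        proof -
          have "H z = - z * of_real ((norm (z - \<tau>))\<^sup>2) * p (of_real r * z)"
            using z by (simp add: H_def bp_factor_on_circle)
          moreover have zw: "z * (cnj z * w) = w" for w using zz by (metis mult.assoc mult_1)
          ultimately show ?thesis unfolding f_def using zz
            by (simp add: zw power2_eq_square algebra_simps del: of_real_power)
        qed
        ultimately have "Re (q z) = Re (cnj z * H 0 - cnj (H 0) * z + of_real ((norm (z - \<tau>))\<^sup>2) * p (of_real r * z))"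
          by metis
        also have "\<dots> = (norm (z - \<tau>))\<^sup>2 * Re (p (of_real r * z))"
          by (simp flip: of_real_power)
        finally have "Re (q z) = (norm (z - \<tau>))\<^sup>2 * Re (p (of_real r * z))" .
        moreover have "of_real r * z \<in> unit_disc" using r z by (simp add: norm_mult)
        ultimately show ?thesis using pos by simp
      qed
    qed
    moreover have "cnj z * f z = of_real ((norm z)\<^sup>2) * q z"
      using q(2)[of z] by (simp add: complex_norm_square mult_ac del: of_real_power)
    ultimately have "Re (cnj z * f z) \<ge> 0" by (simp flip: of_real_power)
    moreover have "cnj z * f z = cnj z * H 0 - of_real ((norm z)\<^sup>2) * (cnj (H 0) * z) - cnj z * H z"
      unfolding complex_norm_square by (simp add: f_def power2_eq_square algebra_simps)
    ultimately have "Re (cnj z * H z) \<le> Re (cnj z * H 0) * (1 - (norm z)\<^sup>2)"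
      by (simp add: algebra_simps flip: of_real_power)
    then show ?thesis by (simp add: H_def)
  qed
  show ?thesis
    unfolding inward_pointing_def
  proof
    fix z :: complex assume z: "z \<in> unit_disc"
    have "isCont p z" using z hol holomorphic_on_imp_continuous_on
      by (metis continuous_on_eq_continuous_at open_ball)
    moreover have "((\<lambda>r. of_real r * z) \<longlongrightarrow> of_real 1 * z) (at_left (1::real))"
      by (intro tendsto_intros)
    ultimately have "((\<lambda>r. p (of_real r * z)) \<longlongrightarrow> p z) (at_left (1::real))"
      using isCont_tendsto_compose[of z p "\<lambda>r. of_real r * z"] by simp
    then have lim: "((\<lambda>r. Re (cnj z * (bp_factor \<tau> z * p (of_real r * z)))) \<longlongrightarrow> Re (cnj z * (bp_factor \<tau> z * p z))) (at_left (1::real))"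
      by (intro tendsto_intros)
    have "eventually (\<lambda>r. Re (cnj z * (bp_factor \<tau> z * p (of_real r * z))) \<le> Re (cnj z * (bp_factor \<tau> 0 * p 0)) * (1 - (norm z)\<^sup>2)) (at_left (1::real))"
      by (rule eventually_at_leftI[of 0]) (use dil[OF z] in auto)
    then show "Re (cnj z * F z) \<le> Re (cnj z * F 0) * (1 - (norm z)\<^sup>2)"
      using tendsto_upperbound[OF lim] z F[of 0] F[OF z] by simp
  qed
qed

section \<open>Generators are inward pointing\<close>

text \<open>The Schwarz lemma after moving \<open>f 0\<close> to \<open>0\<close>.\<close>

lemma Schwarz_Pick_at_0:
  assumes hol: "f holomorphic_on unit_disc" and self: "f \<in> unit_disc \<rightarrow> unit_disc" and z: "z \<in> unit_disc"
  shows "norm (f z - f 0) \<le> norm z * norm (1 - cnj (f 0) * f z)"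
proof -
  have f0: "norm (f 0) < 1" using self by fastforce
  have "norm ((Moebius_function 0 (f 0) \<circ> f) z) \<le> norm z"
  proof (rule Schwarz_Lemma(1))
    show "Moebius_function 0 (f 0) \<circ> f holomorphic_on unit_disc"
      by (rule holomorphic_on_compose_gen[OF hol Moebius_function_holomorphic[OF f0]]) (use self in auto)
    show "norm ((Moebius_function 0 (f 0) \<circ> f) w) < 1" if "norm w < 1" for w
      unfolding o_def by (rule Moebius_function_norm_lt_1[OF f0]) (use self that in fastforce)
  qed (use z in \<open>auto simp: Moebius_function_eq_zero\<close>)
  moreover have "1 - cnj (f 0) * f z \<noteq> 0"
    using cnj_mult_minus_1_neq_0[of "f 0" "f z"] f0 self z by fastforce
  ultimately show ?thesis
    by (simp add: Moebius_function_simple norm_divide divide_le_eq)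
qed

text \<open>\<open>Re (U t)\<close> is the gap in the Schwarz-Pick inequality for \<open>\<phi>\<^sub>t\<close> at \<open>0\<close> and \<open>z\<close>. It is
nonnegative and vanishes at \<open>t = 0\<close>, so its derivative there is nonnegative.\<close>

lemma Gen_imp_inward_pointing:
  assumes "F \<in> Gen"
  shows "inward_pointing F"
proof -
  obtain \<phi> where \<phi>: "holomorphic_semigroup \<phi>" "infinitesimal_generator \<phi> F"
    using assms by (auto simp: Gen_def)
  have id0: "\<phi> 0 w = w" if "w \<in> unit_disc" for w
    using \<phi>(1) that by (auto simp: holomorphic_semigroup_def)
  have d0: "((\<lambda>s. \<phi> s w) has_vector_derivative F w) (at 0 within {0..})" if "w \<in> unit_disc" for w
    using \<phi>(2) id0[OF that] that unfolding infinitesimal_generator_def by fastforce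
  show ?thesis
    unfolding inward_pointing_def
  proof
    fix z :: complex assume z: "z \<in> unit_disc"
    define W where "W t = 1 - cnj (\<phi> t 0) * \<phi> t z" for t
    define V where "V t = \<phi> t z - \<phi> t 0" for t
    define U where "U t = z * cnj z * (W t * cnj (W t)) - V t * cnj (V t)" for t
    have dz: "((\<lambda>s. \<phi> s z) has_vector_derivative F z) (at 0 within {0..})"
      and d00: "((\<lambda>s. \<phi> s 0) has_vector_derivative F 0) (at 0 within {0..})"
      using d0 z by auto
    have dW: "(W has_vector_derivative - (cnj (F 0) * z)) (at 0 within {0..})"
      unfolding W_def using id0[of 0] id0[OF z]
      by (auto intro!: derivative_eq_intros dz has_vector_derivative_cnj d00)
    have dV: "(V has_vector_derivative (F z - F 0)) (at 0 within {0..})"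
      unfolding V_def by (intro derivative_intros dz d00)
    have W0: "W 0 = 1" and V0: "V 0 = z"
      using id0[of 0] id0[OF z] by (auto simp: W_def V_def)
    have "(U has_vector_derivative
        z * cnj z * (W 0 * cnj (- (cnj (F 0) * z)) + - (cnj (F 0) * z) * cnj (W 0))
          - (V 0 * cnj (F z - F 0) + (F z - F 0) * cnj (V 0))) (at 0 within {0..})"
      unfolding U_def
      by (intro has_vector_derivative_diff has_vector_derivative_mult has_vector_derivative_mult_right
            has_vector_derivative_cnj dW dV)
    then have "((\<lambda>t. Re (U t)) has_vector_derivative
        Re (z * cnj z * (W 0 * cnj (- (cnj (F 0) * z)) + - (cnj (F 0) * z) * cnj (W 0))
          - (V 0 * cnj (F z - F 0) + (F z - F 0) * cnj (V 0)))) (at 0 within {0..})"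
      by (rule bounded_linear.has_vector_derivative[OF bounded_linear_Re])
    moreover have "Re (z * cnj z * (W 0 * cnj (- (cnj (F 0) * z)) + - (cnj (F 0) * z) * cnj (W 0))
          - (V 0 * cnj (F z - F 0) + (F z - F 0) * cnj (V 0)))
        = 2 * (Re (cnj z * F 0) * (1 - (norm z)\<^sup>2) - Re (cnj z * F z))"
      unfolding W0 V0 cmod_power2 by (simp add: algebra_simps power2_eq_square)
    ultimately have "((\<lambda>t. Re (U t)) has_real_derivative
        2 * (Re (cnj z * F 0) * (1 - (norm z)\<^sup>2) - Re (cnj z * F z))) (at 0 within {0..})"
      by (simp add: has_real_derivative_iff_has_vector_derivative)
    note der = this
    define A where "A = Re (cnj z * F 0) * (1 - (norm z)\<^sup>2)"
    define B where "B = Re (cnj z * F z)"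
    note der = der[folded A_def B_def]
    have U: "Re (U t) \<ge> 0" if "t \<ge> 0" for t
    proof -
      have "norm (V t) \<le> norm z * norm (W t)"
        unfolding V_def W_def
        by (rule Schwarz_Pick_at_0) (use \<phi>(1) that z in \<open>auto simp: holomorphic_semigroup_def\<close>)
      then have "(norm (V t))\<^sup>2 \<le> (norm z * norm (W t))\<^sup>2" by (intro power_mono) auto
      moreover have "U t = of_real ((norm z * norm (W t))\<^sup>2 - (norm (V t))\<^sup>2)"
        unfolding U_def of_real_diff power_mult_distrib of_real_mult complex_norm_square by simp
      ultimately show ?thesis by simp
    qed
    have U0: "U 0 = 0" by (simp add: U_def W0 V0)
    have "2 * (A - B) < 0 \<Longrightarrow> False"
    proof -
      assume "2 * (A - B) < 0"
      from has_real_derivative_neg_dec_right[OF der this] obtain d where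
        "d > 0" "\<And>h. h > 0 \<Longrightarrow> h \<in> {0..} \<Longrightarrow> h < d \<Longrightarrow> Re (U 0) > Re (U h)"
        by auto
      from this(1) this(2)[of "d/2"] U[of "d/2"] show False by (simp add: U0)
    qed
    then have "B \<le> A" by fastforce
    then show "Re (cnj z * F z) \<le> Re (cnj z * F 0) * (1 - (norm z)\<^sup>2)"
      by (simp only: A_def B_def)
  qed
qed

section \<open>Differences of solutions of an autonomous holomorphic equation\<close>

definition solves :: "(complex \<Rightarrow> complex) \<Rightarrow> (real \<Rightarrow> complex) \<Rightarrow> real set \<Rightarrow> bool" where
  "solves F x S \<longleftrightarrow>
     (\<forall>t\<in>S. x t \<in> unit_disc \<and> (x has_vector_derivative F (x t)) (at t within S))"

lemma solves_subset: "solves F x S \<Longrightarrow> T \<subseteq> S \<Longrightarrow> solves F x T"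
  unfolding solves_def by (meson has_vector_derivative_within_subset subsetD)

lemma solves_continuous: "solves F x S \<Longrightarrow> continuous_on S x"
  unfolding solves_def by (intro continuous_on_vector_derivative[where f' = "\<lambda>t. F (x t)"]) auto

text \<open>The product of \<open>d\<close> with the inverse of the exponential has derivative \<open>0\<close>.\<close>

lemma linear_ode_solution:
  fixes d q :: "real \<Rightarrow> complex"
  assumes d: "\<And>t. t \<in> {0..T} \<Longrightarrow> (d has_vector_derivative q t * d t) (at t within {0..T})"
    and q: "continuous_on {0..T} q" and t: "t \<in> {0..T}"
  shows "d t = d 0 * exp (integral {0..t} q)"
proof -
  define h where "h s = d s * exp (- integral {0..s} q)" for s
  have "h t = h 0"
  proof (rule has_derivative_zero_unique[of "{0..T}"])
    show "(h has_derivative (\<lambda>h. 0)) (at s within {0..T})" if s: "s \<in> {0..T}" for s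
    proof -
      have "((\<lambda>s. integral {0..s} q) has_vector_derivative q s) (at s within {0..T})"
        by (rule integral_has_vector_derivative[OF q s])
      then have "((\<lambda>s. exp (- integral {0..s} q)) has_vector_derivative
          - q s * exp (- integral {0..s} q)) (at s within {0..T})"
        using field_vector_diff_chain_within[where g = exp and g' = "exp (- integral {0..s} q)",
            OF has_vector_derivative_minus[of "\<lambda>s. integral {0..s} q" "q s"]]
        by (simp add: o_def has_field_derivative_at_within)
      from has_vector_derivative_mult[OF d[OF s] this]
      have "(h has_vector_derivative 0) (at s within {0..T})"
        unfolding h_def by (simp add: algebra_simps)
      then show ?thesis by (simp add: has_vector_derivative_def)
    qed
  qed (use t in auto)
  then show ?thesis by (simp add: h_def exp_minus field_simps)
qed

text \<open>The divided difference \<open>(F a - F b) / (a - b)\<close>, written so that it is visibly continuous in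
\<open>(a, b)\<close> also across the diagonal.\<close>

definition mean_slope :: "(complex \<Rightarrow> complex) \<Rightarrow> complex \<Rightarrow> complex \<Rightarrow> complex" where
  "mean_slope F a b = integral {0..1} (\<lambda>s. deriv F (b + of_real s * (a - b)))"

lemma segment_in_disc:
  assumes "a \<in> unit_disc" "b \<in> unit_disc" "s \<in> {0..1}"
  shows "b + of_real s * (a - b) \<in> unit_disc"
proof -
  have "(1 - s) *\<^sub>R b + s *\<^sub>R a \<in> unit_disc"
    using assms convexD_alt[of unit_disc b a s] by (simp add: convex_ball)
  moreover have "(1 - s) *\<^sub>R b + s *\<^sub>R a = b + of_real s * (a - b)"
    by (simp add: scaleR_conv_of_real algebra_simps)
  ultimately show ?thesis by simp
qed

lemma mean_slope_mult:
  assumes hol: "F holomorphic_on unit_disc" and "a \<in> unit_disc" "b \<in> unit_disc"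
  shows "F a - F b = mean_slope F a b * (a - b)"
proof -
  have "((\<lambda>s. deriv F (b + of_real s * (a - b)) * (a - b)) has_integral
      F (b + of_real 1 * (a - b)) - F (b + of_real 0 * (a - b))) {0..1}"
  proof (rule fundamental_theorem_of_calculus)
    fix s :: real assume s: "s \<in> {0..1}"
    have "(F has_field_derivative deriv F (b + of_real s * (a - b))) (at (b + of_real s * (a - b)))"
      by (rule holomorphic_derivI[OF hol open_ball segment_in_disc]) (use assms s in auto)
    moreover have "((\<lambda>w. b + w * (a - b)) has_field_derivative (a - b)) (at (of_real s))"
      by (auto intro!: derivative_eq_intros)
    ultimately have "((\<lambda>w. F (b + w * (a - b))) has_field_derivative
        deriv F (b + of_real s * (a - b)) * (a - b)) (at (of_real s))"
      by (rule DERIV_chain2)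
    then show "((\<lambda>s. F (b + of_real s * (a - b))) has_vector_derivative
        deriv F (b + of_real s * (a - b)) * (a - b)) (at s within {0..1})"
      by (rule has_vector_derivative_real_field)
  qed simp
  from integral_unique[OF this] show ?thesis by (simp add: mean_slope_def)
qed

lemma continuous_on_mean_slope:
  assumes hol: "F holomorphic_on unit_disc"
  shows "continuous_on (unit_disc \<times> unit_disc) (\<lambda>(a, b). mean_slope F a b)"
proof -
  have dF: "continuous_on unit_disc (deriv F)"
    by (intro holomorphic_on_imp_continuous_on holomorphic_deriv hol) auto
  have "continuous_on ((unit_disc \<times> unit_disc) \<times> cbox 0 1)
     (\<lambda>(x, s). deriv F (snd x + of_real s * (fst x - snd x)))"
    unfolding case_prod_unfold
    by (rule continuous_on_compose2[OF dF])
       (auto intro!: continuous_intros segment_in_disc[simplified])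
  from integral_continuous_on_param[OF this] show ?thesis
    by (simp add: mean_slope_def case_prod_unfold)
qed

lemma continuous_on_mean_slope_comp:
  assumes hol: "F holomorphic_on unit_disc"
    and "continuous_on S f" "continuous_on S g" "f ` S \<subseteq> unit_disc" "g ` S \<subseteq> unit_disc"
  shows "continuous_on S (\<lambda>s. mean_slope F (f s) (g s))"
  using continuous_on_compose2[OF continuous_on_mean_slope[OF hol], of S "\<lambda>s. (f s, g s)"] assms
  by (auto intro!: continuous_intros)

text \<open>The difference satisfies the linear equation \<open>d' = mean_slope F (x t) (y t) * d\<close>. The formula
gives uniqueness, Lipschitz bounds and the complex derivative in the initial value.\<close>

lemma solves_difference:
  assumes hol: "F holomorphic_on unit_disc"
    and x: "solves F x {0..T}" and y: "solves F y {0..T}" and t: "t \<in> {0..T}"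
  shows "x t - y t = (x 0 - y 0) * exp (integral {0..t} (\<lambda>s. mean_slope F (x s) (y s)))"
proof -
  have "(\<lambda>t. x t - y t) t = (\<lambda>t. x t - y t) 0 * exp (integral {0..t} (\<lambda>s. mean_slope F (x s) (y s)))"
  proof (rule linear_ode_solution[OF _ _ t])
    show "continuous_on {0..T} (\<lambda>s. mean_slope F (x s) (y s))"
      by (rule continuous_on_mean_slope_comp[OF hol solves_continuous[OF x] solves_continuous[OF y]])
         (use x y in \<open>auto simp: solves_def\<close>)
    fix t assume t: "t \<in> {0..T}"
    have "F (x t) - F (y t) = mean_slope F (x t) (y t) * (x t - y t)"
      by (rule mean_slope_mult[OF hol]) (use x y t in \<open>auto simp: solves_def\<close>)
    moreover have "((\<lambda>t. x t - y t) has_vector_derivative F (x t) - F (y t)) (at t within {0..T})"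
      by (intro has_vector_derivative_diff) (use x y t in \<open>auto simp: solves_def\<close>)
    ultimately show "((\<lambda>t. x t - y t) has_vector_derivative mean_slope F (x t) (y t) * (x t - y t)) (at t within {0..T})"
      by simp
  qed
  then show ?thesis .
qed

lemma solves_unique:
  assumes hol: "F holomorphic_on unit_disc"
    and x: "solves F x {0..T}" and y: "solves F y {0..T}" and "t \<in> {0..T}" and "x 0 = y 0"
  shows "x t = y t"
  using solves_difference[OF assms(1-4)] assms(5) by simp

section \<open>Global solutions for inward pointing fields\<close>

text \<open>By the inward pointing condition \<open>(1 - |x|^2) * exp (2 * |F 0| * t)\<close> has nonnegative derivative.\<close>

lemma solves_confined:
  assumes inw: "inward_pointing F" and x: "solves F x {0..T}" and t: "t \<in> {0..T}"
  shows "(1 - (norm (x 0))\<^sup>2) * exp (- 2 * norm (F 0) * t) \<le> 1 - (norm (x t))\<^sup>2"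
proof -
  define c where "c = 2 * norm (F 0)"
  define h where "h s = (1 - (norm (x s))\<^sup>2) * exp (c * s)" for s
  have cx: "continuous_on {0..t} x"
    using solves_continuous[OF x] t by (auto intro: continuous_on_subset)
  have "h 0 \<le> h t"
  proof (rule DERIV_nonneg_imp_increasing_open[where f = h])
    show "0 \<le> t" using t by simp
    show "continuous_on {0..t} h"
      unfolding h_def by (intro continuous_intros cx)
    fix s assume s: "0 < s" "s < t"
    then have sT: "s \<in> {0..T}" using t by auto
    have "(x has_vector_derivative F (x s)) (at s within {0..T})"
      using x sT by (auto simp: solves_def)
    then have xs: "(x has_vector_derivative F (x s)) (at s)"
      using s t by (simp add: at_within_Icc_at)
    then have "((\<lambda>s. x s * cnj (x s)) has_vector_derivative (x s * cnj (F (x s)) + F (x s) * cnj (x s))) (at s)"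
      by (intro has_vector_derivative_mult has_vector_derivative_cnj)
    then have "((\<lambda>s. Re (x s * cnj (x s))) has_vector_derivative Re (x s * cnj (F (x s)) + F (x s) * cnj (x s))) (at s)"
      by (rule bounded_linear.has_vector_derivative[OF bounded_linear_Re])
    moreover have "(\<lambda>s. Re (x s * cnj (x s))) = (\<lambda>s. (norm (x s))\<^sup>2)"
      by (simp add: cmod_power2 fun_eq_iff flip: power2_eq_square)
    ultimately have "((\<lambda>s. (norm (x s))\<^sup>2) has_real_derivative 2 * Re (cnj (x s) * F (x s))) (at s)"
      by (simp add: has_real_derivative_iff_has_vector_derivative algebra_simps)
    moreover have "((\<lambda>s. (1 - N s) * exp (c * s)) has_real_derivative
        (1 - N s) * (c * exp (c * s)) - N' * exp (c * s)) (at s)"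
      if "(N has_real_derivative N') (at s)" for N N'
      using that by (auto intro!: derivative_eq_intros)
    ultimately have "(h has_real_derivative
        (1 - (norm (x s))\<^sup>2) * (c * exp (c * s)) - 2 * Re (cnj (x s) * F (x s)) * exp (c * s)) (at s)"
      unfolding h_def by blast
    moreover have "(1 - (norm (x s))\<^sup>2) * (c * exp (c * s)) - 2 * Re (cnj (x s) * F (x s)) * exp (c * s) \<ge> 0"
    proof -
      have xD: "norm (x s) < 1" using x sT by (auto simp: solves_def)
      then have pos: "1 - (norm (x s))\<^sup>2 \<ge> 0" by (simp add: power_le_one)
      have "Re (cnj (x s) * F 0) \<le> norm (x s) * norm (F 0)"
        by (metis complex_Re_le_cmod complex_mod_cnj norm_mult)
      also have "\<dots> \<le> norm (F 0)" using xD by (simp add: mult_left_le_one_le)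
      finally have "Re (cnj (x s) * F 0) * (1 - (norm (x s))\<^sup>2) \<le> norm (F 0) * (1 - (norm (x s))\<^sup>2)"
        by (rule mult_right_mono[OF _ pos])
      moreover have "Re (cnj (x s) * F (x s)) \<le> Re (cnj (x s) * F 0) * (1 - (norm (x s))\<^sup>2)"
        using inw xD by (simp add: inward_pointing_def)
      ultimately have "(1 - (norm (x s))\<^sup>2) * c - 2 * Re (cnj (x s) * F (x s)) \<ge> 0"
        by (simp add: c_def algebra_simps)
      then have "((1 - (norm (x s))\<^sup>2) * c - 2 * Re (cnj (x s) * F (x s))) * exp (c * s) \<ge> 0"
        by simp
      then show ?thesis by (simp add: algebra_simps)
    qed
    ultimately show "\<exists>y. (h has_real_derivative y) (at s) \<and> 0 \<le> y" by blast
  qed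
  then have "(1 - (norm (x 0))\<^sup>2) \<le> (1 - (norm (x t))\<^sup>2) * exp (c * t)" by (simp add: h_def)
  then show ?thesis by (simp add: c_def exp_minus field_simps)
qed

text \<open>The bound is uniform in the initial value, so on a bounded time interval all solutions that
start in a compact part of the disc share a compact part of the disc.\<close>

lemma solves_in_smaller_cball:
  assumes inw: "inward_pointing F" and "r < 1" "0 \<le> T"
  obtains R where "R < 1" "\<And>x t. solves F x {0..t} \<Longrightarrow> norm (x 0) \<le> r \<Longrightarrow> t \<in> {0..T} \<Longrightarrow> norm (x t) \<le> R"
proof -
  \<comment> \<open>The bound at the largest admissible \<open>|x 0|\<close> and the latest time; \<open>max r 0\<close> covers negative
    \<open>r\<close>, for which there is no such initial value.\<close>
  define \<epsilon> where "\<epsilon> = (1 - (max r 0)\<^sup>2) * exp (- 2 * norm (F 0) * T)"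
  have r: "0 < 1 - (max r 0)\<^sup>2" using \<open>r < 1\<close> by (simp add: power_less_one_iff max_def)
  then have \<epsilon>: "0 < \<epsilon>" by (simp add: \<epsilon>_def)
  show ?thesis
  proof
    show "sqrt (1 - \<epsilon>) < 1" using \<epsilon> by simp
    fix x t assume x: "solves F x {0..t}" "norm (x 0) \<le> r" and t: "t \<in> {0..T}"
    have "\<epsilon> \<le> (1 - (norm (x 0))\<^sup>2) * exp (- 2 * norm (F 0) * t)"
      unfolding \<epsilon>_def
    proof (rule mult_mono)
      show "1 - (max r 0)\<^sup>2 \<le> 1 - (norm (x 0))\<^sup>2"
        using x(2) by (simp add: power_mono)
      then show "0 \<le> 1 - (norm (x 0))\<^sup>2" using r by linarith
      show "exp (- 2 * norm (F 0) * T) \<le> exp (- 2 * norm (F 0) * t)"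
        using t by (simp add: mult_left_mono)
    qed simp
    also have "\<dots> \<le> 1 - (norm (x t))\<^sup>2"
      using solves_confined[OF inw x(1), of t] t by simp
    finally show "norm (x t) \<le> sqrt (1 - \<epsilon>)"
      by (intro real_le_rsqrt) simp
  qed
qed

text \<open>At a zero of \<open>F\<close> a constant is a solution. Elsewhere the variables can be separated: let \<open>h\<close> be a
primitive of \<open>1 / F\<close>; then \<open>h (x t) = h z + t\<close> is solved for \<open>x\<close> by a local inverse of \<open>h\<close>.\<close>

lemma solves_local_existence:
  assumes hol: "F holomorphic_on unit_disc" and z: "z \<in> unit_disc"
  obtains \<delta> x where "\<delta> > 0" "x 0 = z" "solves F x {0..\<delta>}"
proof (cases "F z = 0")
  case True
  then have "solves F (\<lambda>_. z) {0..1}" using z by (simp add: solves_def)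
  then show ?thesis using that[of 1 "\<lambda>_. z"] by simp
next
  case False
  have "continuous_on unit_disc F" by (rule holomorphic_on_imp_continuous_on[OF hol])
  then have "open (unit_disc \<inter> F -` (- {0}))"
    by (rule continuous_open_preimage) auto
  moreover have "unit_disc \<inter> F -` (- {0}) = {w\<in>unit_disc. F w \<noteq> 0}" by blast
  ultimately have "open {w\<in>unit_disc. F w \<noteq> 0}" by simp
  then obtain \<rho> where \<rho>: "\<rho> > 0" "ball z \<rho> \<subseteq> {w\<in>unit_disc. F w \<noteq> 0}"
    using False z by (metis (mono_tags, lifting) mem_Collect_eq open_contains_ball)
  have "(\<lambda>w. 1 / F w) holomorphic_on ball z \<rho>"
    using \<rho>(2) by (intro holomorphic_intros holomorphic_on_subset[OF hol]) auto
  then obtain h where h: "\<And>w. w \<in> ball z \<rho> \<Longrightarrow> (h has_field_derivative 1 / F w) (at w)"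
    using holomorphic_convex_primitive'[of "ball z \<rho>" "\<lambda>w. 1 / F w"] 
    by (metis at_within_open convex_ball open_ball)
  then have holh: "h holomorphic_on ball z \<rho>"
    by (meson at_within_open field_differentiable_at_within field_differentiable_def holomorphic_on_def)
  have "deriv h z \<noteq> 0" using h[of z] \<rho>(1) False by (simp add: DERIV_imp_deriv)
  then obtain r where r: "r > 0" "ball z r \<subseteq> ball z \<rho>" "open (h ` ball z r)" "inj_on h (ball z r)"
    using has_complex_derivative_locally_invertible[OF holh, of z] \<rho>(1) by auto
  obtain g where g: "g holomorphic_on h ` ball z r" "\<And>w. w \<in> ball z r \<Longrightarrow> deriv h w * deriv g (h w) = 1"
    "\<And>w. w \<in> ball z r \<Longrightarrow> g (h w) = w"
    using holomorphic_has_inverse[OF holomorphic_on_subset[OF holh r(2)] open_ball r(4)] by blast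
  obtain e where e: "e > 0" "ball (h z) e \<subseteq> h ` ball z r"
    using r(1,3) by (metis centre_in_ball image_eqI open_contains_ball)
  define x where "x t = g (h z + of_real t)" for t :: real
  have "solves F x {0..e/2}"
    unfolding solves_def
  proof
    fix t assume t: "t \<in> {0..e/2}"
    then have "h z + of_real t \<in> ball (h z) e" using e(1) by (simp add: dist_norm)
    then obtain w where w: "w \<in> ball z r" "h z + of_real t = h w" using e(2) by blast
    have xt: "x t = w" using g(3)[OF w(1)] w(2) by (simp add: x_def)
    have "deriv h w = 1 / F w" using h[of w] w r(2) by (intro DERIV_imp_deriv) auto
    then have "(1 / F w) * deriv g (h w) = 1" using g(2)[OF w(1)] by simp
    moreover have "F w \<noteq> 0" "w \<in> unit_disc" using w(1) r(2) \<rho>(2) by auto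
    ultimately have "deriv g (h w) = F w" by (simp add: field_simps)
    then have "(g has_field_derivative F w) (at (h z + of_real t))"
      using holomorphic_derivI[OF g(1) r(3), of "h w"] w by auto
    moreover have "((\<lambda>s. h z + s) has_field_derivative 1) (at (of_real t))"
      by (auto intro!: derivative_eq_intros)
    ultimately have "((\<lambda>s. g (h z + s)) has_field_derivative F w * 1) (at (of_real t))"
      by (rule DERIV_chain2)
    then have "(x has_vector_derivative F w) (at t within {0..e/2})"
      unfolding x_def using has_vector_derivative_real_field by fastforce
    then show "x t \<in> unit_disc \<and> (x has_vector_derivative F (x t)) (at t within {0..e/2})"
      using xt \<open>w \<in> unit_disc\<close> by simp
  qed
  moreover have "x 0 = z" using g(3)[of z] r(1) by (simp add: x_def)
  ultimately show ?thesis using that[of "e/2" x] e(1) by simp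
qed

lemma solves_append:
  assumes x: "solves F x {0..T}" and y: "solves F y {0..\<delta>}" and "x T = y 0" "0 \<le> T" "0 \<le> \<delta>"
  shows "solves F (\<lambda>t. if t \<in> {0..T} then x t else y (t - T)) {0..T + \<delta>}"
  unfolding solves_def
proof
  fix t assume t: "t \<in> {0..T + \<delta>}"
  have cl: "{0..T} \<union> closure {0..T} \<inter> closure {T..T+\<delta>} = {0..T}"
      "{T..T+\<delta>} \<union> closure {0..T} \<inter> closure {T..T+\<delta>} = {T..T+\<delta>}"
    using assms by auto
  have ys: "((\<lambda>t. y (t - T)) has_vector_derivative F (y (t - T))) (at t within {T..T+\<delta>})"
    if "t \<in> {T..T+\<delta>}" for t
  proof -
    have "(\<lambda>t. t - T) ` {T..T+\<delta>} = {0..\<delta>}"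
      by (simp add: image_minus_const_atLeastAtMost')
    moreover have "(y has_vector_derivative F (y (t - T))) (at (t - T) within {0..\<delta>})"
      using y that by (auto simp: solves_def)
    ultimately have "((y \<circ> (\<lambda>t. t - T)) has_vector_derivative 1 *\<^sub>R F (y (t - T))) (at t within {T..T+\<delta>})"
      by (intro vector_diff_chain_within) (auto intro!: derivative_eq_intros)
    then show ?thesis by (simp add: o_def)
  qed
  have "((\<lambda>t. if t \<in> {0..T} then x t else y (t - T)) has_vector_derivative
      (if t \<in> {0..T} then F (x t) else F (y (t - T)))) (at t within {0..T + \<delta>})"
  proof (rule has_vector_derivative_If_within_closures[where T = "{T..T+\<delta>}"], unfold cl)
    show "{0..T + \<delta>} = {0..T} \<union> {T..T + \<delta>}" using assms by auto
    show "(x has_vector_derivative F (x t)) (at t within {0..T})" if "t \<in> {0..T}"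
      using x that by (auto simp: solves_def)
  qed (use t ys assms(3) in auto)
  moreover have "(if t \<in> {0..T} then x t else y (t - T)) \<in> unit_disc"
    using x y t by (auto simp: solves_def)
  ultimately show "(if t \<in> {0..T} then x t else y (t - T)) \<in> unit_disc \<and>
      ((\<lambda>t. if t \<in> {0..T} then x t else y (t - T)) has_vector_derivative
        F (if t \<in> {0..T} then x t else y (t - T))) (at t within {0..T + \<delta>})"
    by (auto split: if_splits)
qed

text \<open>The solution stays in a compact subset of the disc on which \<open>F\<close> is bounded, so it is Lipschitz
and extends continuously to \<open>B\<close>. By continuity the integral equation then holds at \<open>B\<close> too.\<close>

lemma solves_extends_to_endpoint:
  assumes hol: "F holomorphic_on unit_disc" and inw: "inward_pointing F" and B: "B > 0"
    and X: "\<And>T. 0 \<le> T \<Longrightarrow> T < B \<Longrightarrow> solves F X {0..T}"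
  obtains g where "solves F g {0..B}" "g 0 = X 0"
proof -
  have X0: "X 0 \<in> unit_disc" using X[of 0] B by (auto simp: solves_def)
  obtain R where R: "R < 1"
    "\<And>x t. solves F x {0..t} \<Longrightarrow> norm (x 0) \<le> norm (X 0) \<Longrightarrow> t \<in> {0..B} \<Longrightarrow> norm (x t) \<le> R"
    by (rule solves_in_smaller_cball[OF inw, of "norm (X 0)" B]) (use X0 B in auto)
  have XR: "X t \<in> cball 0 R" if "t \<in> {0..<B}" for t
    using R(2)[of X t] X[of t] that by auto
  have sub: "cball 0 R \<subseteq> unit_disc" using R(1) by auto
  have Fcont: "continuous_on (cball 0 R) F"
    by (rule continuous_on_subset[OF holomorphic_on_imp_continuous_on[OF hol] sub])
  obtain M where M: "M \<ge> 0" "\<And>w. w \<in> cball 0 R \<Longrightarrow> norm (F w) \<le> M"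
    using compact_imp_bounded[OF compact_continuous_image[OF Fcont compact_cball]]
    unfolding bounded_pos by (metis imageI less_imp_le)
  have Xd: "(X has_vector_derivative F (X t)) (at t within {0..<B})" if t: "t \<in> {0..<B}" for t
  proof -
    have "(X has_vector_derivative F (X t)) (at t within {0..(t+B)/2})"
      using X[of "(t+B)/2"] t by (auto simp: solves_def)
    moreover have "at t within {0..<B} = at t within {0..(t+B)/2}"
      by (rule at_within_nhd[of _ "{..<(t+B)/2}"]) (use t in auto)
    ultimately show ?thesis by simp
  qed
  have "M-lipschitz_on {0..<B} X"
  proof (rule bounded_derivative_imp_lipschitz)
    show "(X has_derivative (\<lambda>h. h *\<^sub>R F (X t))) (at t within {0..<B})" if "t \<in> {0..<B}" for t
      using Xd[OF that] by (simp add: has_vector_derivative_def)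
    show "onorm (\<lambda>h. h *\<^sub>R F (X t)) \<le> M" if "t \<in> {0..<B}" for t
      by (rule onorm_bound) (use M(1) M(2)[OF XR[OF that]] in \<open>auto simp: mult.commute[of M] intro: mult_left_mono\<close>)
  qed (use M(1) in auto)
  then obtain g where g: "M-lipschitz_on (closure {0..<B}) g" "\<And>t. t \<in> {0..<B} \<Longrightarrow> g t = X t"
    using lipschitz_extend_closure by blast
  have cl: "closure {0..<B} = {0..B}" using B by simp
  have gc: "continuous_on {0..B} g" using lipschitz_on_continuous_on[OF g(1)] cl by simp
  have gR: "g t \<in> cball 0 R" if "t \<in> {0..B}" for t
  proof -
    have "g ` closure {0..<B} \<subseteq> cball 0 R"
      by (rule image_closure_subset) (use gc cl g(2) XR in auto)
    then show ?thesis using that cl by blast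
  qed
  have Fg: "continuous_on {0..B} (\<lambda>t. F (g t))"
    by (rule continuous_on_compose2[OF Fcont gc]) (use gR in auto)
  have I: "((\<lambda>t. integral {0..t} (\<lambda>t. F (g t))) has_vector_derivative F (g t)) (at t within {0..B})"
    if "t \<in> {0..B}" for t
    by (rule integral_has_vector_derivative[OF Fg that])
  define h where "h t = g t - integral {0..t} (\<lambda>t. F (g t))" for t
  have hB: "h t = h 0" if "t \<in> {0..<B}" for t
  proof (rule has_derivative_zero_unique[of "{0..<B}"])
    show "(h has_derivative (\<lambda>h. 0)) (at s within {0..<B})" if s: "s \<in> {0..<B}" for s
    proof -
      have "(g has_vector_derivative F (g s)) (at s within {0..<B})"
        using has_vector_derivative_transform_within[OF Xd[OF s], of 1 g] g(2) s by auto
      moreover have "((\<lambda>t. integral {0..t} (\<lambda>t. F (g t))) has_vector_derivative F (g s)) (at s within {0..<B})"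
        by (rule has_vector_derivative_within_subset[OF I]) (use s in auto)
      ultimately have "(h has_vector_derivative F (g s) - F (g s)) (at s within {0..<B})"
        unfolding h_def by (rule has_vector_derivative_diff)
      then show ?thesis by (simp add: has_vector_derivative_def)
    qed
  qed (use that B in auto)
  have hc: "continuous_on (closure {0..<B}) h"
    unfolding h_def cl by (intro continuous_intros gc continuous_on_vector_derivative[OF I])
  have h: "h t = h 0" if "t \<in> {0..B}" for t
    by (rule continuous_constant_on_closure[OF hc hB]) (use that cl in auto)
  have geq: "g t = h 0 + integral {0..t} (\<lambda>t. F (g t))" if "t \<in> {0..B}" for t
    using h[OF that] unfolding h_def[of t] by (simp add: diff_eq_eq)
  have "solves F g {0..B}"
    unfolding solves_def
  proof
    fix t assume t: "t \<in> {0..B}"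
    have "((\<lambda>t. h 0 + integral {0..t} (\<lambda>t. F (g t))) has_vector_derivative 0 + F (g t)) (at t within {0..B})"
      by (intro derivative_intros I t)
    then have "(g has_vector_derivative F (g t)) (at t within {0..B})"
      using has_vector_derivative_transform[OF t, of g] geq by fastforce
    then show "g t \<in> unit_disc \<and> (g has_vector_derivative F (g t)) (at t within {0..B})"
      using gR[OF t] sub by blast
  qed
  then show ?thesis using that[of g] g(2)[of 0] B by simp
qed

text \<open>Let \<open>B\<close> be the supremum of the times up to which a solution exists. If it were finite, the
solution would reach \<open>B\<close> by confinement and could be continued beyond by local existence.
By uniqueness the solutions on different intervals fit together to the diagonal
\<open>X t = sol t t\<close>.\<close>

lemma solves_global_existence:
  assumes hol: "F holomorphic_on unit_disc" and inw: "inward_pointing F" and z: "z \<in> unit_disc"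
  obtains x where "x 0 = z" "solves F x {0..}"
proof -
  define P where "P T \<longleftrightarrow> (\<exists>x. x 0 = z \<and> solves F x {0..T})" for T
  define sol where "sol T = (SOME x. x 0 = z \<and> solves F x {0..T})" for T
  have sol: "sol T 0 = z" "solves F (sol T) {0..T}" if "P T" for T
    using someI_ex[of "\<lambda>x. x 0 = z \<and> solves F x {0..T}"] that unfolding P_def sol_def by auto
  have mono: "P S" if "P T" "S \<le> T" for S T
    using that unfolding P_def by (metis atLeastatMost_subset_iff order.refl solves_subset)
  define X where "X t = sol t t" for t
  have X: "X s = sol T s" if "P T" "0 \<le> s" "s \<le> T" for s T
    unfolding X_def
  proof (rule solves_unique[OF hol, of "sol s" s "sol T" s])
    show "solves F (sol s) {0..s}" using sol mono that by blast
    show "solves F (sol T) {0..s}" using sol(2)[OF that(1)] that by (auto intro: solves_subset)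
    show "sol s 0 = sol T 0" using sol(1) mono that by metis
  qed (use that in auto)
  have solX: "solves F X {0..T}" if "P T" for T
    unfolding solves_def
  proof
    fix t assume t: "t \<in> {0..T}"
    have "(sol T has_vector_derivative F (X t)) (at t within {0..T})" "sol T t \<in> unit_disc"
      using sol(2)[OF that] t X[OF that, of t] by (auto simp: solves_def)
    then show "X t \<in> unit_disc \<and> (X has_vector_derivative F (X t)) (at t within {0..T})"
      using has_vector_derivative_transform[OF t, of X "sol T"] X[OF that] t by auto
  qed
  have ext: "\<exists>T'>T. P T'" if T: "P T" "0 \<le> T" for T
  proof -
    obtain x where x: "x 0 = z" "solves F x {0..T}" using T(1) by (auto simp: P_def)
    then have "x T \<in> unit_disc" using T(2) by (auto simp: solves_def)
    then obtain \<delta> y where y: "\<delta> > 0" "y 0 = x T" "solves F y {0..\<delta>}"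
      using solves_local_existence[OF hol] by metis
    have "solves F (\<lambda>t. if t \<in> {0..T} then x t else y (t - T)) {0..T + \<delta>}"
      by (rule solves_append[OF x(2) y(3)]) (use y T in auto)
    then have "P (T + \<delta>)" unfolding P_def using x(1) T(2)
      by (intro exI[of _ "\<lambda>t. if t \<in> {0..T} then x t else y (t - T)"]) auto
    then show ?thesis using y(1) by (intro exI[of _ "T + \<delta>"]) auto
  qed
  have P0: "P 0"
  proof -
    have "at (0::real) within {0..0} = bot" by (simp add: at_within_def)
    then have "solves F (\<lambda>_. z) {0..0}"
      using z by (auto simp: solves_def has_vector_derivative_def has_derivative_def bounded_linear_scaleR_left)
    then show ?thesis by (auto simp: P_def)
  qed
  have all: "P T" if "0 \<le> T" for T
  proof (rule ccontr)
    assume nP: "\<not> P T"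
    define A where "A = {t. 0 \<le> t \<and> P t}"
    define B where "B = Sup A"
    have bdd: "bdd_above A"
      unfolding A_def using nP mono by (intro bdd_aboveI[of _ T]) (metis mem_Collect_eq nle_le)
    obtain T1 where T1: "T1 > 0" "P T1" using ext[OF P0] by auto
    then have T1A: "T1 \<in> A" by (simp add: A_def)
    then have B0: "B > 0" unfolding B_def
      using cSup_upper[OF _ bdd] T1(1) by fastforce
    have PB: "P t" if tB: "t < B" for t
    proof -
      have "A \<noteq> {}" using T1A by auto
      then obtain s where "s \<in> A" "t < s"
        using tB less_cSup_iff[OF _ bdd, of t] by (auto simp: B_def)
      then show ?thesis using mono[of s t] by (simp add: A_def)
    qed
    obtain g where "solves F g {0..B}" "g 0 = X 0"
      using solves_extends_to_endpoint[OF hol inw B0, of X] solX PB by blast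
    moreover have "X 0 = z" using sol(1)[OF P0] by (simp add: X_def)
    ultimately have "P B" by (auto simp: P_def)
    then obtain T' where "T' > B" "P T'" using ext[of B] B0 by auto
    then have "T' \<in> A" using B0 by (simp add: A_def)
    then show False using cSup_upper[OF _ bdd] \<open>T' > B\<close> unfolding B_def by fastforce
  qed
  have "solves F X {0..}"
    unfolding solves_def
  proof
    fix t :: real assume t: "t \<in> {0..}"
    have "X t \<in> unit_disc \<and> (X has_vector_derivative F (X t)) (at t within {0..t+1})"
      using solX[OF all, of "t+1"] t by (auto simp: solves_def)
    moreover have "at t within {0..} = at t within {0..t+1}"
      by (rule at_within_nhd[of _ "{..<t+1}"]) auto
    ultimately show "X t \<in> unit_disc \<and> (X has_vector_derivative F (X t)) (at t within {0..})"
      by simp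
  qed
  moreover have "X 0 = z" using sol(1)[OF P0] by (simp add: X_def)
  ultimately show ?thesis using that by blast
qed

section \<open>Inward pointing fields are generators\<close>

text \<open>The exponent in the difference formula is bounded by \<open>M * T\<close>, where \<open>M\<close> bounds the divided
difference on the compact set that contains the trajectories.\<close>

lemma flow_lipschitz_on_ball:
  assumes hol: "F holomorphic_on unit_disc" and inw: "inward_pointing F"
    and sol: "\<And>z. z \<in> unit_disc \<Longrightarrow> solves F (\<lambda>t. \<phi> t z) {0..}"
    and init: "\<And>z. z \<in> unit_disc \<Longrightarrow> \<phi> 0 z = z"
    and "r < 1" "0 \<le> T"
  obtains L where "\<And>t. t \<in> {0..T} \<Longrightarrow> L-lipschitz_on (ball 0 r) (\<phi> t)"
proof -
  obtain R where R: "R < 1"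
    "\<And>x t. solves F x {0..t} \<Longrightarrow> norm (x 0) \<le> r \<Longrightarrow> t \<in> {0..T} \<Longrightarrow> norm (x t) \<le> R"
    by (rule solves_in_smaller_cball[OF inw \<open>r < 1\<close> \<open>0 \<le> T\<close>]) blast
  have \<phi>R: "\<phi> t z \<in> cball 0 R" if "z \<in> ball 0 r" "t \<in> {0..T}" for z t
    using R(2)[of "\<lambda>t. \<phi> t z" t] solves_subset[OF sol, of z "{0..t}"] init[of z] that \<open>r < 1\<close> by auto
  have sub: "cball 0 R \<subseteq> unit_disc" using R(1) by auto
  have "continuous_on (cball 0 R \<times> cball 0 R) (\<lambda>(a, b). mean_slope F a b)"
    by (rule continuous_on_subset[OF continuous_on_mean_slope[OF hol]]) (use sub in auto)
  then have "compact ((\<lambda>(a, b). mean_slope F a b) ` (cball 0 R \<times> cball 0 R))"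
    by (intro compact_continuous_image compact_Times compact_cball)
  from compact_imp_bounded[OF this] obtain M where M: "M > 0"
    "\<And>y. y \<in> (\<lambda>(a, b). mean_slope F a b) ` (cball 0 R \<times> cball 0 R) \<Longrightarrow> norm y \<le> M"
    unfolding bounded_pos by blast
  have "(exp (M * T))-lipschitz_on (ball 0 r) (\<phi> t)" if t: "t \<in> {0..T}" for t
  proof (rule lipschitz_onI)
    fix w z :: complex assume w: "w \<in> ball 0 r" and z: "z \<in> ball 0 r"
    have D: "w \<in> unit_disc" "z \<in> unit_disc" using w z \<open>r < 1\<close> by auto
    have sols: "solves F (\<lambda>t. \<phi> t w) {0..t}" "solves F (\<lambda>t. \<phi> t z) {0..t}"
      using sol[OF D(1)] sol[OF D(2)] by (auto intro: solves_subset)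
    have "norm (integral {0..t} (\<lambda>s. mean_slope F (\<phi> s w) (\<phi> s z))) \<le> M * (t - 0)"
    proof (rule integral_bound)
      show "continuous_on {0..t} (\<lambda>s. mean_slope F (\<phi> s w) (\<phi> s z))"
        by (rule continuous_on_mean_slope_comp[OF hol solves_continuous[OF sols(1)] solves_continuous[OF sols(2)]])
           (use sols in \<open>auto simp: solves_def\<close>)
      show "norm (mean_slope F (\<phi> s w) (\<phi> s z)) \<le> M" if "s \<in> {0..t}" for s
      proof (rule M(2))
        have "(\<phi> s w, \<phi> s z) \<in> cball 0 R \<times> cball 0 R"
          using \<phi>R[OF w, of s] \<phi>R[OF z, of s] that t by auto
        then show "mean_slope F (\<phi> s w) (\<phi> s z) \<in> (\<lambda>(a, b). mean_slope F a b) ` (cball 0 R \<times> cball 0 R)"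
          by (metis (no_types, lifting) case_prod_conv imageI)
      qed
    qed (use t in auto)
    also have "\<dots> \<le> M * T" using t M(1) by simp
    finally have "norm (exp (integral {0..t} (\<lambda>s. mean_slope F (\<phi> s w) (\<phi> s z)))) \<le> exp (M * T)"
      using norm_exp[of "integral {0..t} (\<lambda>s. mean_slope F (\<phi> s w) (\<phi> s z))"]
      by (meson exp_le_cancel_iff order_trans)
    moreover have "\<phi> t w - \<phi> t z = (w - z) * exp (integral {0..t} (\<lambda>s. mean_slope F (\<phi> s w) (\<phi> s z)))"
      using solves_difference[OF hol sols, of t] init D t by simp
    ultimately show "dist (\<phi> t w) (\<phi> t z) \<le> exp (M * T) * dist w z"
      by (auto simp: dist_norm norm_mult mult.commute intro: mult_left_mono)
  qed simp
  then show ?thesis using that by blast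
qed

text \<open>By the difference formula the difference quotient of \<open>\<phi>\<^sub>t\<close> at \<open>z\<close> is
\<open>E w = exp (integral of mean_slope F (\<phi>\<^sub>s w) (\<phi>\<^sub>s z))\<close>. It is continuous in \<open>w\<close> because the
integrand is jointly continuous; hence it converges as \<open>w\<close> tends to \<open>z\<close>.\<close>

lemma flow_holomorphic:
  assumes hol: "F holomorphic_on unit_disc" and inw: "inward_pointing F"
    and sol: "\<And>z. z \<in> unit_disc \<Longrightarrow> solves F (\<lambda>t. \<phi> t z) {0..}"
    and init: "\<And>z. z \<in> unit_disc \<Longrightarrow> \<phi> 0 z = z"
    and t: "0 \<le> t"
  shows "\<phi> t holomorphic_on unit_disc"
  unfolding holomorphic_on_open[OF open_ball]
proof
  fix z :: complex assume z: "z \<in> unit_disc"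
  define r where "r = (norm z + 1) / 2"
  have r: "r < 1" "z \<in> ball 0 r" using z by (auto simp: r_def)
  have rD: "ball 0 r \<subseteq> unit_disc" using r(1) by auto
  obtain L where L: "\<And>s. s \<in> {0..t} \<Longrightarrow> L-lipschitz_on (ball 0 r) (\<phi> s)"
    by (rule flow_lipschitz_on_ball[OF hol inw sol init r(1) t]) blast+
  have \<phi>D: "\<phi> s w \<in> unit_disc" if "w \<in> unit_disc" "0 \<le> s" for s w
    using sol[OF that(1)] that(2) by (auto simp: solves_def)
  have cont: "continuous_on {0..t} (\<lambda>s. \<phi> s w)" if "w \<in> unit_disc" for w
    using solves_continuous[OF sol[OF that]] by (rule continuous_on_subset) auto
  have "local_lipschitz {0..t} (ball 0 r) \<phi>"
    by (rule local_lipschitzI, rule exI[of _ 1], intro conjI exI[of _ L] ballI)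
       (use L in \<open>auto intro: lipschitz_on_subset\<close>)
  then have joint: "continuous_on ({0..t} \<times> ball 0 r) (\<lambda>(s, w). \<phi> s w)"
    by (rule continuous_on_TimesI) (use cont rD in auto)
  define E where "E w = exp (integral {0..t} (\<lambda>s. mean_slope F (\<phi> s w) (\<phi> s z)))" for w
  have 1: "continuous_on (ball 0 r \<times> cbox 0 t) (\<lambda>x. \<phi> (snd x) (fst x))"
  proof -
    have "continuous_on (ball 0 r \<times> cbox 0 t) (\<lambda>x. (\<lambda>(s, w). \<phi> s w) (snd x, fst x))"
      by (rule continuous_on_compose2[OF joint]) (auto intro!: continuous_intros)
    then show ?thesis by simp
  qed
  have 2: "continuous_on (ball 0 r \<times> cbox 0 t) (\<lambda>x. \<phi> (snd x) z)"
    by (rule continuous_on_compose2[OF cont[OF z]]) (auto intro!: continuous_intros)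
  have "continuous_on (ball 0 r \<times> cbox 0 t) (\<lambda>(w, s). mean_slope F (\<phi> s w) (\<phi> s z))"
    unfolding case_prod_unfold
  proof (rule continuous_on_mean_slope_comp[OF hol 1 2]; rule image_subsetI)
    fix x :: "complex \<times> real" assume "x \<in> ball 0 r \<times> cbox 0 t"
    then have "fst x \<in> unit_disc" "0 \<le> snd x" using rD by auto
    then show "\<phi> (snd x) (fst x) \<in> unit_disc" "\<phi> (snd x) z \<in> unit_disc" using \<phi>D z by blast+
  qed
  then have "continuous_on (ball 0 r) E"
    unfolding E_def using integral_continuous_on_param by (intro continuous_intros) fastforce
  then have "isCont E z" using r(2) by (simp add: continuous_on_eq_continuous_at)
  then have "(E \<longlongrightarrow> E z) (at z)" by (simp add: isCont_def)
  moreover have "eventually (\<lambda>w. w \<in> ball 0 r - {z}) (at z)"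
    by (rule eventually_at_in_open[OF open_ball r(2)])
  then have "eventually (\<lambda>w. E w = (\<phi> t w - \<phi> t z) / (w - z)) (at z)"
  proof eventually_elim
    case (elim w)
    then have w: "w \<in> unit_disc" using rD by blast
    have "solves F (\<lambda>t. \<phi> t w) {0..t}" "solves F (\<lambda>t. \<phi> t z) {0..t}"
      using sol[OF w] sol[OF z] by (auto intro: solves_subset)
    from solves_difference[OF hol this, of t] show ?case
      using init[OF w] init[OF z] elim t by (simp add: E_def field_simps)
  qed
  ultimately have "((\<lambda>w. (\<phi> t w - \<phi> t z) / (w - z)) \<longlongrightarrow> E z) (at z)"
    by (rule Lim_transform_eventually)
  then show "\<exists>f'. (\<phi> t has_field_derivative f') (at z)"
    by (auto simp: has_field_derivative_iff)
qed

text \<open>The semigroup law is uniqueness for the shifted trajectory. Convergence to the identity on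
compact sets holds because the speed \<open>|F|\<close> is bounded by some \<open>M\<close> along all trajectories that
start in the set, for times up to \<open>1\<close>.\<close>

lemma inward_pointing_imp_Gen:
  assumes hol: "F holomorphic_on unit_disc" and inw: "inward_pointing F"
  shows "F \<in> Gen"
proof -
  obtain \<phi> where init: "\<And>z. z \<in> unit_disc \<Longrightarrow> \<phi> 0 z = z"
    and sol: "\<And>z. z \<in> unit_disc \<Longrightarrow> solves F (\<lambda>t. \<phi> t z) {0..}"
  proof -
    have "\<forall>z. \<exists>x. z \<in> unit_disc \<longrightarrow> x 0 = z \<and> solves F x {0..}"
      using solves_global_existence[OF assms] by metis
    then obtain x where "\<And>z. z \<in> unit_disc \<Longrightarrow> x z 0 = z \<and> solves F (x z) {0..}" by metis
    then show ?thesis using that[of "\<lambda>t z. x z t"] by auto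
  qed
  have \<phi>D: "\<phi> s w \<in> unit_disc" if "w \<in> unit_disc" "0 \<le> s" for s w
    using sol[OF that(1)] that(2) by (auto simp: solves_def)
  have "infinitesimal_generator \<phi> F"
    unfolding infinitesimal_generator_def using hol sol by (auto simp: solves_def)
  moreover have "holomorphic_semigroup \<phi>"
    unfolding holomorphic_semigroup_def
  proof (intro conjI allI impI ballI)
    show "\<phi> t holomorphic_on unit_disc" if "0 \<le> t" for t
      by (rule flow_holomorphic[OF hol inw sol init that])
    show "\<phi> t \<in> unit_disc \<rightarrow> unit_disc" if "0 \<le> t" for t
      using \<phi>D that by blast
    show "\<phi> 0 z = z" if "z \<in> unit_disc" for z by (rule init[OF that])
    show "\<phi> (t + s) z = \<phi> t (\<phi> s z)" if "0 \<le> t" "0 \<le> s" "z \<in> unit_disc" for t s z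
    proof (rule solves_unique[OF hol, of "\<lambda>t. \<phi> (t + s) z" t "\<lambda>t. \<phi> t (\<phi> s z)"])
      show "solves F (\<lambda>t. \<phi> (t + s) z) {0..t}"
        unfolding solves_def
      proof
        fix u assume u: "u \<in> {0..t}"
        have "((\<lambda>t. \<phi> t z) has_vector_derivative F (\<phi> (u + s) z)) (at (u + s) within {0..})"
          using sol[OF that(3)] u that by (auto simp: solves_def)
        then have "((\<lambda>t. \<phi> t z) has_vector_derivative F (\<phi> (u + s) z)) (at (u + s) within (\<lambda>t. t + s) ` {0..t})"
          by (rule has_vector_derivative_within_subset) (use that in auto)
        then have "(((\<lambda>t. \<phi> t z) \<circ> (\<lambda>t. t + s)) has_vector_derivative 1 *\<^sub>R F (\<phi> (u + s) z)) (at u within {0..t})"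
          by (intro vector_diff_chain_within) (auto intro!: derivative_eq_intros)
        then show "\<phi> (u + s) z \<in> unit_disc \<and> ((\<lambda>t. \<phi> (t + s) z) has_vector_derivative F (\<phi> (u + s) z)) (at u within {0..t})"
          using \<phi>D[OF that(3), of "u + s"] u that by (simp add: o_def)
      qed
      show "solves F (\<lambda>t. \<phi> t (\<phi> s z)) {0..t}"
        using sol[OF \<phi>D[OF that(3,2)]] by (rule solves_subset) auto
      show "\<phi> (0 + s) z = \<phi> 0 (\<phi> s z)" using init[OF \<phi>D[OF that(3,2)]] by simp
    qed (use that in auto)
    fix K :: "complex set" assume K: "compact K \<and> K \<subseteq> unit_disc"
    obtain r where r: "r < 1" "K \<subseteq> cball 0 r"
      using compact_subset_disc K by metis
    obtain R where R: "R < 1"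
      "\<And>x t. solves F x {0..t} \<Longrightarrow> norm (x 0) \<le> r \<Longrightarrow> t \<in> {0..1} \<Longrightarrow> norm (x t) \<le> R"
      by (rule solves_in_smaller_cball[OF inw r(1), of 1]) auto
    have Fcont: "continuous_on (cball 0 R) F"
      by (rule continuous_on_subset[OF holomorphic_on_imp_continuous_on[OF hol]]) (use R(1) in auto)
    obtain M where M: "M > 0" "\<And>w. w \<in> cball 0 R \<Longrightarrow> norm (F w) \<le> M"
      using compact_imp_bounded[OF compact_continuous_image[OF Fcont compact_cball]]
      unfolding bounded_pos by (metis imageI)
    have bound: "norm (\<phi> t z - z) \<le> M * t" if "z \<in> K" "t \<in> {0..1}" for z t
    proof -
      have zD: "z \<in> unit_disc" using that K by auto
      have "norm ((\<lambda>t. \<phi> t z) t - (\<lambda>t. \<phi> t z) 0) \<le> M * norm (t - 0)"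
      proof (rule differentiable_bound[of "{0..t}" _ "\<lambda>s h. h *\<^sub>R F (\<phi> s z)"])
        fix s assume s: "s \<in> {0..t}"
        have "solves F (\<lambda>t. \<phi> t z) {0..t}" using sol[OF zD] by (rule solves_subset) auto
        then show "((\<lambda>t. \<phi> t z) has_derivative (\<lambda>h. h *\<^sub>R F (\<phi> s z))) (at s within {0..t})"
          using s by (auto simp: solves_def has_vector_derivative_def)
        have "solves F (\<lambda>t. \<phi> t z) {0..s}" using sol[OF zD] by (rule solves_subset) auto
        then have "\<phi> s z \<in> cball 0 R"
          using R(2)[of "\<lambda>t. \<phi> t z" s] init[OF zD] that s r(2) by auto
        then show "onorm (\<lambda>h. h *\<^sub>R F (\<phi> s z)) \<le> M"
          by (intro onorm_bound) (use M in \<open>auto simp: mult.commute[of M] intro: mult_left_mono\<close>)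
      qed (use that in auto)
      then show ?thesis using init[OF zD] that by simp
    qed
    show "uniform_limit K \<phi> (\<lambda>z. z) (at 0 within {0..})"
      unfolding uniform_limit_iff
    proof (intro allI impI)
      fix e :: real assume e: "e > 0"
      define d where "d = min 1 (e / (2 * M))"
      have d: "d > 0" using e M(1) by (simp add: d_def)
      have "\<forall>z\<in>K. dist (\<phi> t z) z < e" if "t \<in> {0..}" "dist t 0 < d" for t
      proof
        fix z assume "z \<in> K"
        have t: "t \<in> {0..1}" "t < e / (2 * M)" using that by (auto simp: d_def dist_norm)
        have "M * t < e" using t(2) M(1) e by (simp add: field_simps)
        then show "dist (\<phi> t z) z < e" using bound[OF \<open>z \<in> K\<close> t(1)] by (simp add: dist_norm)
      qed
      then show "\<forall>\<^sub>F t in at 0 within {0..}. \<forall>z\<in>K. dist (\<phi> t z) z < e"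
        unfolding eventually_at using d by (intro exI[of _ d]) auto
    qed
  qed
  ultimately show ?thesis by (auto simp: Gen_def)
qed

section \<open>Uniqueness of the Berkson-Porta point\<close>

text \<open>\<open>F\<close> vanishes at \<open>\<tau>\<close>, so in the factorization with \<open>\<sigma> \<noteq> \<tau>\<close> the function \<open>p\<close> vanishes there,
and a function with nonnegative real part that vanishes somewhere is zero.\<close>

lemma bp_point_unique_interior:
  assumes hol: "F holomorphic_on unit_disc" and nz: "\<exists>z\<in>unit_disc. F z \<noteq> 0"
    and bp: "bp_point F \<tau>" "bp_point F \<sigma>" and \<tau>: "\<tau> \<in> unit_disc" and \<sigma>: "\<sigma> \<in> cball 0 1"
  shows "\<tau> = \<sigma>"
proof (rule ccontr)
  assume ne: "\<tau> \<noteq> \<sigma>"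
  obtain p where p: "p holomorphic_on unit_disc" "\<And>z. z \<in> unit_disc \<Longrightarrow> Re (p z) \<ge> 0"
    "\<And>z. z \<in> unit_disc \<Longrightarrow> F z = bp_factor \<sigma> z * p z"
    using bp_point_imp_factorization[OF hol bp(2) \<sigma>] by blast
  have "bp_factor \<sigma> \<tau> \<noteq> 0" using bp_factor_eq_0_iff[of \<sigma> \<tau>] \<tau> \<sigma> ne by simp
  then have "p \<tau> = 0" using p(3)[OF \<tau>] bp_point_zero[OF hol bp(1) \<tau>] by simp
  then have "p z = 0" if "z \<in> unit_disc" for z
    using constant_if_Re_nonneg_attains_0[OF p(1,2) \<tau> _ that] by simp
  then show False using nz p(3) by auto
qed

text \<open>Rotate so that \<open>\<tau> = cis \<alpha>\<close> and \<open>\<sigma> = cis (- \<alpha>)\<close>. At a real \<open>x\<close> the two factors are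
\<open>cos \<alpha> * (1 + x^2) - 2 * x \<plusminus> \<i> * sin \<alpha> * (1 - x^2)\<close>, so they are opposite if the real part
vanishes. Geometrically, \<open>x\<close> is where the diameter meets the geodesic from \<open>\<tau>\<close> to \<open>\<sigma>\<close>.\<close>

lemma bp_factors_opposite:
  assumes "norm \<tau> = 1" "norm \<sigma> = 1" "\<tau> \<noteq> \<sigma>"
  obtains z where "z \<in> unit_disc" "bp_factor \<sigma> z = - bp_factor \<tau> z"
proof -
  define A B where "A = Arg \<tau>" and "B = Arg \<sigma>"
  \<comment> \<open>\<open>\<omega>\<close> is the direction of the axis of symmetry of the two points.\<close>
  define \<alpha> where "\<alpha> = (A - B) / 2"
  define \<omega> where "\<omega> = cis ((A + B) / 2)"
  have "\<tau> \<noteq> 0" "\<sigma> \<noteq> 0" using assms by auto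
  have \<tau>: "\<tau> = \<omega> * cis \<alpha>"
    using \<open>\<tau> \<noteq> 0\<close> assms(1) cis_Arg[of \<tau>] by (auto simp: \<omega>_def \<alpha>_def cis_mult A_def sgn_div_norm field_simps)
  have \<sigma>: "\<sigma> = \<omega> * cis (- \<alpha>)"
    using \<open>\<sigma> \<noteq> 0\<close> assms(2) cis_Arg[of \<sigma>] by (auto simp: \<omega>_def \<alpha>_def cis_mult B_def sgn_div_norm field_simps)
  have \<omega>: "\<omega> * cnj \<omega> = 1" "norm \<omega> = 1" by (auto simp: \<omega>_def cis_cnj cis_mult)
  have \<omega>': "\<omega> * (cnj \<omega> * w) = w" for w using \<omega>(1) by (metis mult.assoc mult_1)
  have sin: "sin \<alpha> \<noteq> 0"
  proof
    assume "sin \<alpha> = 0"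
    then have "cis \<alpha> = cis (- \<alpha>)" by (simp add: complex_eq_iff)
    then show False using \<tau> \<sigma> assms(3) by simp
  qed
  define s where "s = \<bar>sin \<alpha>\<bar>"
  \<comment> \<open>The root in the disc of \<open>cos \<alpha> * (1 + x^2) = 2 * x\<close>.\<close>
  define x where "x = cos \<alpha> / (1 + s)"
  have s: "s > 0" using sin by (simp add: s_def)
  have sc: "(cos \<alpha>)\<^sup>2 + s\<^sup>2 = 1" by (simp add: s_def)
  have x: "cos \<alpha> * (1 + x\<^sup>2) = 2 * x"
  proof -
    have "(1 + s)\<^sup>2 + (cos \<alpha>)\<^sup>2 = 2 * (1 + s)"
      using sc by (simp add: power2_eq_square algebra_simps)
    then have "1 + x\<^sup>2 = 2 / (1 + s)"
      using s by (simp add: x_def power_divide add_divide_eq_iff) (simp add: power2_eq_square divide_simps)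
    then show ?thesis by (simp add: x_def)
  qed
  have "\<bar>cos \<alpha>\<bar> < 1 + s" using abs_cos_le_one[of \<alpha>] s by linarith
  then have "\<bar>x\<bar> < 1" using s by (simp add: x_def)
  have key: "bp_factor (\<omega> * cis \<beta>) (\<omega> * of_real x) = \<omega> * (\<i> * of_real (sin \<beta> * (1 - x\<^sup>2)))"
    if "cos \<beta> * (1 + x\<^sup>2) = 2 * x" for \<beta>
  proof -
    have "(of_real x - cis \<beta>) * (cnj (cis \<beta>) * of_real x - 1) = \<i> * of_real (sin \<beta> * (1 - x\<^sup>2))"
    proof -
      obtain c d where cd: "cis \<beta> = Complex c d" "c = cos \<beta>" "d = sin \<beta>" "c * c + d * d = 1"
        by (simp add: cis.ctr)
      have "(of_real x - Complex c d) * (cnj (Complex c d) * of_real x - 1)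
          = Complex (c * (1 + x\<^sup>2) - x - x * (c * c + d * d)) (d * (1 - x\<^sup>2))"
        by (rule complex_eqI) (simp_all add: algebra_simps power2_eq_square)
      also have "c * (1 + x\<^sup>2) - x - x * (c * c + d * d) = 0"
        using that unfolding cd(4) cd(2)[symmetric] by simp
      finally show ?thesis
        unfolding cd(1) cd(3)[symmetric] by (simp add: complex_eq_iff)
    qed
    moreover have "bp_factor (\<omega> * cis \<beta>) (\<omega> * of_real x)
        = \<omega> * ((of_real x - cis \<beta>) * (cnj (cis \<beta>) * of_real x - 1))"
      by (simp add: bp_factor_def algebra_simps \<omega>')
    ultimately show ?thesis by simp
  qed
  have "bp_factor \<sigma> (\<omega> * of_real x) = - bp_factor \<tau> (\<omega> * of_real x)"
    unfolding \<tau> \<sigma> using key[of \<alpha>] key[of "- \<alpha>"] x by simp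
  moreover have "\<omega> * of_real x \<in> unit_disc" using \<open>\<bar>x\<bar> < 1\<close> \<omega>(2) by (simp add: norm_mult)
  ultimately show ?thesis using that by blast
qed

text \<open>For two different boundary points let \<open>w\<close> be a point where the factors are opposite. Then the
two cofactors satisfy \<open>q w = - p w\<close>, so both real parts vanish at \<open>w\<close> and both cofactors are
constant. The factors would then be opposite everywhere, which their values at \<open>0\<close> and \<open>1/2\<close>
exclude.\<close>

lemma bp_point_unique:
  assumes hol: "F holomorphic_on unit_disc" and nz: "\<exists>z\<in>unit_disc. F z \<noteq> 0"
    and bp: "bp_point F \<tau>" "bp_point F \<sigma>" and \<tau>: "\<tau> \<in> cball 0 1" and \<sigma>: "\<sigma> \<in> cball 0 1"
  shows "\<tau> = \<sigma>"
proof (rule ccontr)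
  assume ne: "\<tau> \<noteq> \<sigma>"
  have "norm \<tau> = 1" "norm \<sigma> = 1"
    using bp_point_unique_interior[OF hol nz bp] bp_point_unique_interior[OF hol nz bp(2,1)] \<tau> \<sigma> ne
    by fastforce+
  then obtain w where w: "w \<in> unit_disc" "bp_factor \<sigma> w = - bp_factor \<tau> w"
    using bp_factors_opposite ne by metis
  obtain p where p: "p holomorphic_on unit_disc" "\<And>z. z \<in> unit_disc \<Longrightarrow> Re (p z) \<ge> 0"
    "\<And>z. z \<in> unit_disc \<Longrightarrow> F z = bp_factor \<tau> z * p z"
    using bp_point_imp_factorization[OF hol bp(1) \<tau>] by blast
  obtain q where q: "q holomorphic_on unit_disc" "\<And>z. z \<in> unit_disc \<Longrightarrow> Re (q z) \<ge> 0"
    "\<And>z. z \<in> unit_disc \<Longrightarrow> F z = bp_factor \<sigma> z * q z"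
    using bp_point_imp_factorization[OF hol bp(2) \<sigma>] by blast
  have "bp_factor \<tau> w \<noteq> 0"
    using bp_factor_eq_0_iff[of \<tau> w] w(1) \<tau> \<open>norm \<tau> = 1\<close> by auto
  moreover have "bp_factor \<tau> w * (q w + p w) = 0"
  proof -
    have "bp_factor \<tau> w * p w = - (bp_factor \<tau> w * q w)"
      using p(3)[OF w(1)] q(3)[OF w(1)] w(2) by simp
    then show ?thesis by (simp add: distrib_left)
  qed
  ultimately have pq: "q w = - p w" by (simp add: eq_neg_iff_add_eq_0)
  then have Re0: "Re (p w) = 0" "Re (q w) = 0" using p(2)[OF w(1)] q(2)[OF w(1)] by auto
  have "p z = p w" "q z = q w" if "z \<in> unit_disc" for z
    using constant_if_Re_nonneg_attains_0[OF p(1,2) w(1) Re0(1) that]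
      constant_if_Re_nonneg_attains_0[OF q(1,2) w(1) Re0(2) that] by auto
  then have F: "F z = bp_factor \<tau> z * p w" "F z = - bp_factor \<sigma> z * p w" if "z \<in> unit_disc" for z
    using p(3)[OF that] q(3)[OF that] pq that by auto
  have "p w \<noteq> 0" using nz F(1) by auto
  then have eq: "bp_factor \<tau> z = - bp_factor \<sigma> z" if "z \<in> unit_disc" for z
    using F[OF that] by (metis mult_cancel_right)
  have "\<tau> = - \<sigma>" using eq[of 0] by (simp add: bp_factor_def)
  moreover have "\<sigma> * cnj \<sigma> = 1" using complex_norm_square[of \<sigma>] \<open>norm \<sigma> = 1\<close> by simp
  ultimately show False using eq[of "1/2"] by (simp add: bp_factor_def algebra_simps)
qed

section \<open>Measurable choice of the Berkson-Porta point\<close>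

lemma nonneg_if_nonneg_on_dense:
  fixes h :: "'a::metric_space \<Rightarrow> real"
  assumes cont: "continuous_on S h" and Z: "S \<subseteq> closure Z" "Z \<subseteq> S"
    and nn: "\<And>z. z \<in> Z \<Longrightarrow> h z \<ge> 0" and z: "z \<in> S"
  shows "h z \<ge> 0"
proof -
  obtain s where s: "\<And>n. s n \<in> Z" "s \<longlonglongrightarrow> z"
    using Z(1) z closure_sequential by blast
  have "(\<lambda>n. h (s n)) \<longlonglongrightarrow> h z"
    by (rule continuous_on_tendsto_compose[OF cont s(2) z], rule always_eventually)
       (use s(1) Z(2) in blast)
  then show ?thesis by (rule LIMSEQ_le_const) (use nn s(1) in auto)
qed

lemma bp_point_if_on_dense:
  assumes cont: "continuous_on unit_disc F" and Z: "unit_disc \<subseteq> closure Z" "Z \<subseteq> unit_disc"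
    and h: "\<And>z. z \<in> Z \<Longrightarrow> Re (F z * cnj (bp_factor \<tau> z)) \<ge> 0"
  shows "bp_point F \<tau>"
  unfolding bp_point_def
proof
  have "continuous_on unit_disc (\<lambda>z. Re (F z * cnj (bp_factor \<tau> z)))"
    unfolding bp_factor_def by (intro continuous_intros cont)
  then show "Re (F z * cnj (bp_factor \<tau> z)) \<ge> 0" if "z \<in> unit_disc" for z
    by (rule nonneg_if_nonneg_on_dense[OF _ Z h that])
qed

text \<open>With \<open>\<zeta>\<close> enumerating a dense subset of the disc and \<open>W\<close> dense in \<open>C\<close>, a Berkson-Porta point
in \<open>C\<close> exists iff for every \<open>n\<close> some \<open>\<tau> \<in> W\<close> satisfies the first \<open>n + 1\<close> inequalities up to an
error \<open>1 / (n + 1)\<close>: one direction is density of \<open>W\<close>, the other is compactness of \<open>C\<close>.\<close>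

lemma sets_bp_point_in_compact:
  fixes G :: "complex \<Rightarrow> 'a \<Rightarrow> complex"
  assumes meas: "\<And>z. z \<in> unit_disc \<Longrightarrow> G z \<in> borel_measurable M"
    and cont: "\<And>t. t \<in> space M \<Longrightarrow> continuous_on unit_disc (\<lambda>z. G z t)"
    and C: "compact C"
  shows "{t \<in> space M. \<exists>\<tau>\<in>C. bp_point (\<lambda>z. G z t) \<tau>} \<in> sets M"
proof -
  obtain Z where Z: "countable Z" "Z \<subseteq> unit_disc" "unit_disc \<subseteq> closure Z"
    by (rule separable)
  then have "Z \<noteq> {}" by auto
  define \<zeta> where "\<zeta> = from_nat_into Z"
  have \<zeta>: "range \<zeta> = Z" unfolding \<zeta>_def by (rule range_from_nat_into) fact+
  then have \<zeta>D: "\<zeta> k \<in> unit_disc" for k using Z(2) \<zeta> by blast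
  obtain W where W: "countable W" "W \<subseteq> C" "C \<subseteq> closure W"
    by (rule separable)
  define h where "h t \<tau> z = Re (G z t * cnj (bp_factor \<tau> z))" for t \<tau> z
  define A where "A n \<tau> k = {t \<in> space M. h t \<tau> (\<zeta> k) > - inverse (real (Suc n))}" for n \<tau> k
  have A: "A n \<tau> k \<in> sets M" for n \<tau> k
  proof -
    have [measurable]: "G (\<zeta> k) \<in> borel_measurable M" by (rule meas[OF \<zeta>D])
    show ?thesis unfolding A_def h_def by measurable
  qed
  have hcont: "continuous_on UNIV (\<lambda>\<tau>. h t \<tau> z)" for t z
    unfolding h_def bp_factor_def by (intro continuous_intros)
  have "{t \<in> space M. \<exists>\<tau>\<in>C. bp_point (\<lambda>z. G z t) \<tau>} = (\<Inter>n. \<Union>\<tau>\<in>W. \<Inter>k\<in>{..n}. A n \<tau> k)"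
  proof (intro equalityI subsetI)
    fix t assume "t \<in> {t \<in> space M. \<exists>\<tau>\<in>C. bp_point (\<lambda>z. G z t) \<tau>}"
    then obtain \<tau> where t: "t \<in> space M" and \<tau>: "\<tau> \<in> C" "bp_point (\<lambda>z. G z t) \<tau>" by auto
    show "t \<in> (\<Inter>n. \<Union>\<tau>\<in>W. \<Inter>k\<in>{..n}. A n \<tau> k)"
    proof
      fix n
      define U where "U = (\<Inter>k\<in>{..n}. {\<sigma>. h t \<sigma> (\<zeta> k) > - inverse (real (Suc n))})"
      have "open U" unfolding U_def
        by (intro open_INT ballI finite_atMost open_Collect_less hcont continuous_on_const)
      moreover have "\<tau> \<in> U"
        using \<tau>(2) \<zeta>D unfolding U_def bp_point_def h_def
        by (auto intro: less_le_trans[of _ 0])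
      ultimately obtain \<sigma> where "\<sigma> \<in> W" "\<sigma> \<in> U"
        using \<tau>(1) W(3) closure_iff_nhds_not_empty[of \<tau> W] by blast
      then show "t \<in> (\<Union>\<tau>\<in>W. \<Inter>k\<in>{..n}. A n \<tau> k)"
        using t by (auto simp: A_def U_def)
    qed
  next
    fix t assume t: "t \<in> (\<Inter>n. \<Union>\<tau>\<in>W. \<Inter>k\<in>{..n}. A n \<tau> k)"
    then have "\<forall>n. \<exists>\<sigma>\<in>W. \<forall>k\<in>{..n}. t \<in> A n \<sigma> k" by auto
    then obtain \<sigma> where \<sigma>: "\<And>n. \<sigma> n \<in> W" "\<And>n k. k \<in> {..n} \<Longrightarrow> t \<in> A n (\<sigma> n) k" by metis
    have ts: "t \<in> space M" using \<sigma>(2)[of 0 0] by (simp add: A_def)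
    have "\<forall>n. \<sigma> n \<in> C" using \<sigma>(1) W(2) by auto
    then obtain \<tau> \<rho> where \<tau>: "\<tau> \<in> C" "strict_mono (\<rho> :: nat \<Rightarrow> nat)" "(\<sigma> \<circ> \<rho>) \<longlonglongrightarrow> \<tau>"
      using C unfolding compact_eq_seq_compact_metric seq_compact_def by metis
    have "h t \<tau> (\<zeta> k) \<ge> 0" for k
    proof (rule LIMSEQ_le)
      have "isCont (\<lambda>\<tau>. h t \<tau> (\<zeta> k)) \<tau>"
        using hcont by (simp add: continuous_on_eq_continuous_at)
      then show "(\<lambda>n. h t ((\<sigma> \<circ> \<rho>) n) (\<zeta> k)) \<longlonglongrightarrow> h t \<tau> (\<zeta> k)"
        by (rule isCont_tendsto_compose[OF _ \<tau>(3)])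
      have "(\<lambda>n. - inverse (real (Suc n))) \<longlonglongrightarrow> - 0"
        by (intro tendsto_intros LIMSEQ_inverse_real_of_nat)
      from LIMSEQ_subseq_LIMSEQ[OF this \<tau>(2)]
      show "(\<lambda>n. - inverse (real (Suc (\<rho> n)))) \<longlonglongrightarrow> 0" by (simp add: o_def)
      show "\<exists>N. \<forall>n\<ge>N. - inverse (real (Suc (\<rho> n))) \<le> h t ((\<sigma> \<circ> \<rho>) n) (\<zeta> k)"
      proof (intro exI[of _ k] allI impI)
        fix n assume "k \<le> n"
        then have "k \<in> {..\<rho> n}" using seq_suble[OF \<tau>(2), of n] by simp
        from \<sigma>(2)[OF this] show "- inverse (real (Suc (\<rho> n))) \<le> h t ((\<sigma> \<circ> \<rho>) n) (\<zeta> k)"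
          by (simp add: A_def)
      qed
    qed
    then have "bp_point (\<lambda>z. G z t) \<tau>"
      by (intro bp_point_if_on_dense[OF cont[OF ts] Z(3,2)]) (use \<zeta> in \<open>auto simp: h_def\<close>)
    then show "t \<in> {t \<in> space M. \<exists>\<tau>\<in>C. bp_point (\<lambda>z. G z t) \<tau>}"
      using ts \<tau>(1) by auto
  qed
  moreover have "(\<Inter>n. \<Union>\<tau>\<in>W. \<Inter>k\<in>{..n}. A n \<tau> k) \<in> sets M"
  proof (intro sets.countable_INT image_subsetI)
    fix n
    show "(\<Union>\<tau>\<in>W. \<Inter>k\<in>{..n}. A n \<tau> k) \<in> sets M"
      by (rule sets.countable_UN''[OF W(1)]) (auto intro!: sets.finite_INT A)
  qed simp
  ultimately show ?thesis by simp
qed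

lemma sets_nonzero:
  fixes G :: "complex \<Rightarrow> 'a \<Rightarrow> complex"
  assumes meas: "\<And>z. z \<in> unit_disc \<Longrightarrow> G z \<in> borel_measurable M"
    and cont: "\<And>t. t \<in> space M \<Longrightarrow> continuous_on unit_disc (\<lambda>z. G z t)"
  shows "{t \<in> space M. \<exists>z\<in>unit_disc. G z t \<noteq> 0} \<in> sets M"
proof -
  obtain Z where Z: "countable Z" "Z \<subseteq> unit_disc" "unit_disc \<subseteq> closure Z"
    by (rule separable)
  have "G z t = 0" if t: "t \<in> space M" and z: "z \<in> unit_disc" and 0: "\<And>w. w \<in> Z \<Longrightarrow> G w t = 0" for z t
  proof -
    have "continuous_on unit_disc (\<lambda>z. - norm (G z t))" by (intro continuous_intros cont t)
    from nonneg_if_nonneg_on_dense[OF this Z(3,2) _ z] show ?thesis using 0 by simp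
  qed
  then have "{t \<in> space M. \<exists>z\<in>unit_disc. G z t \<noteq> 0} = (\<Union>z\<in>Z. {t \<in> space M. G z t \<noteq> 0})"
    using Z(2) by blast
  also have "\<dots> \<in> sets M"
  proof (rule sets.countable_UN''[OF Z(1)])
    fix z assume "z \<in> Z"
    then have [measurable]: "G z \<in> borel_measurable M" using meas Z(2) by blast
    show "{t \<in> space M. G z t \<noteq> 0} \<in> sets M" by measurable
  qed
  finally show ?thesis .
qed

text \<open>Where \<open>G\<close> has a unique Berkson-Porta point (the predicate \<open>N\<close>), that point and its cofactor are
taken; elsewhere \<open>\<tau>\<close> and \<open>p\<close> are \<open>0\<close>, which is right wherever \<open>G\<close> vanishes. By uniqueness
\<open>\<tau> t \<in> S\<close> iff some Berkson-Porta point lies in \<open>S\<close>, so \<open>\<tau>\<close> is measurable.\<close>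

lemma measurable_factorization:
  fixes G :: "complex \<Rightarrow> 'a \<Rightarrow> complex"
  assumes meas: "\<And>z. z \<in> unit_disc \<Longrightarrow> G z \<in> borel_measurable M"
    and hol: "\<And>t. t \<in> space M \<Longrightarrow> (\<lambda>z. G z t) holomorphic_on unit_disc"
  obtains \<tau> p where "\<tau> \<in> borel_measurable M" "\<And>t. \<tau> t \<in> cball 0 1"
    "\<And>z. z \<in> unit_disc \<Longrightarrow> p z \<in> borel_measurable M"
    "\<And>t. (\<lambda>z. p z t) holomorphic_on unit_disc" "\<And>z t. z \<in> unit_disc \<Longrightarrow> Re (p z t) \<ge> 0"
    "\<And>t z. t \<in> space M \<Longrightarrow> \<exists>\<sigma>\<in>cball 0 1. bp_point (\<lambda>z. G z t) \<sigma> \<Longrightarrow> z \<in> unit_disc \<Longrightarrow>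
        G z t = bp_factor (\<tau> t) z * p z t"
proof -
  have cont: "continuous_on unit_disc (\<lambda>z. G z t)" if "t \<in> space M" for t
    by (rule holomorphic_on_imp_continuous_on[OF hol[OF that]])
  define N where "N t \<longleftrightarrow> t \<in> space M \<and> (\<exists>z\<in>unit_disc. G z t \<noteq> 0) \<and> (\<exists>\<sigma>\<in>cball 0 1. bp_point (\<lambda>z. G z t) \<sigma>)" for t
  define \<tau> where "\<tau> t = (if N t then (THE \<sigma>. \<sigma> \<in> cball 0 1 \<and> bp_point (\<lambda>z. G z t) \<sigma>) else 0)" for t
  have \<tau>N: "\<tau> t \<in> cball 0 1 \<and> bp_point (\<lambda>z. G z t) (\<tau> t)" if "N t" for t
  proof -
    have "\<exists>!\<sigma>. \<sigma> \<in> cball 0 1 \<and> bp_point (\<lambda>z. G z t) \<sigma>"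
      using that bp_point_unique[OF hol, of t] unfolding N_def by blast
    from theI'[OF this] show ?thesis using that by (simp add: \<tau>_def)
  qed
  have \<tau>iff: "\<tau> t \<in> S \<longleftrightarrow> (\<exists>\<sigma>\<in>cball 0 1 \<inter> S. bp_point (\<lambda>z. G z t) \<sigma>)" if "N t" for t S
    using \<tau>N[OF that] bp_point_unique[OF hol, of t] that unfolding N_def by blast
  have Nset: "{t \<in> space M. N t} \<in> sets M"
  proof -
    have "{t \<in> space M. N t} = {t \<in> space M. \<exists>z\<in>unit_disc. G z t \<noteq> 0} \<inter>
        {t \<in> space M. \<exists>\<sigma>\<in>cball 0 1. bp_point (\<lambda>z. G z t) \<sigma>}"
      by (auto simp: N_def)
    then show ?thesis
      using sets_nonzero[OF meas cont] sets_bp_point_in_compact[OF meas cont compact_cball] by auto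
  qed
  have \<tau>meas: "\<tau> \<in> borel_measurable M"
    unfolding borel_eq_closed
  proof (rule measurable_measure_of)
    fix S :: "complex set" assume "S \<in> Collect closed"
    then have "compact (cball 0 1 \<inter> S)" by (simp add: compact_Int_closed)
    then have "{t \<in> space M. \<exists>\<sigma>\<in>cball 0 1 \<inter> S. bp_point (\<lambda>z. G z t) \<sigma>} \<in> sets M" (is "?E \<in> _")
      using sets_bp_point_in_compact[OF meas cont, of "cball 0 1 \<inter> S"] by blast
    then have "({t \<in> space M. N t} \<inter> ?E) \<union> (if 0 \<in> S then space M - {t \<in> space M. N t} else {}) \<in> sets M"
      using Nset by auto
    also have "({t \<in> space M. N t} \<inter> ?E) \<union> (if 0 \<in> S then space M - {t \<in> space M. N t} else {})
        = \<tau> -` S \<inter> space M"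
    proof (intro set_eqI)
      fix t
      show "t \<in> ({t \<in> space M. N t} \<inter> ?E) \<union> (if 0 \<in> S then space M - {t \<in> space M. N t} else {})
        \<longleftrightarrow> t \<in> \<tau> -` S \<inter> space M"
      proof (cases "N t")
        case True
        then show ?thesis using \<tau>iff[OF True, of S] by auto
      next
        case False
        then show ?thesis by (auto simp: \<tau>_def)
      qed
    qed
    finally show "\<tau> -` S \<inter> space M \<in> sets M" .
  qed auto
  have "\<exists>q. q holomorphic_on unit_disc \<and> (\<forall>z\<in>unit_disc. Re (q z) \<ge> 0) \<and>
      (\<forall>z\<in>unit_disc. G z t = bp_factor (\<tau> t) z * q z)" if "N t" for t
  proof -
    have "(\<lambda>z. G z t) holomorphic_on unit_disc" using hol that by (simp add: N_def)
    from bp_point_imp_factorization[OF this, of "\<tau> t"] \<tau>N[OF that] show ?thesis by metis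
  qed
  then obtain q where q: "\<And>t. N t \<Longrightarrow> q t holomorphic_on unit_disc"
    "\<And>t z. N t \<Longrightarrow> z \<in> unit_disc \<Longrightarrow> Re (q t z) \<ge> 0"
    "\<And>t z. N t \<Longrightarrow> z \<in> unit_disc \<Longrightarrow> G z t = bp_factor (\<tau> t) z * q t z"
    by metis
  define p where "p z t = (if N t then q t z else 0)" for z t
  have pmeas: "p z \<in> borel_measurable M" if z: "z \<in> unit_disc" for z
  proof (rule borel_measurable_LIMSEQ_metric)
    \<comment> \<open>For \<open>z = \<tau> t\<close> the value \<open>p z t\<close> is not a quotient; it is the limit of quotients along a fixed
      injective sequence in the disc, which meets \<open>\<tau> t\<close> at most once.\<close>
    define s where "s n = z + of_real ((1 - norm z) / real (n + 2))" for n
    have sD: "s n \<in> unit_disc" for n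
    proof -
      have "norm (s n) \<le> norm z + (1 - norm z) / real (n + 2)"
        unfolding s_def using z norm_triangle_ineq[of z "of_real ((1 - norm z) / real (n + 2))"]
        by (simp only: norm_of_real) simp
      also have "\<dots> < norm z + (1 - norm z) / 1"
        using z by (intro add_strict_left_mono divide_strict_left_mono) auto
      finally show ?thesis by simp
    qed
    have slim: "s \<longlonglongrightarrow> z"
    proof -
      have "(\<lambda>n. (1 - norm z) / real (n + 2)) \<longlonglongrightarrow> 0" by real_asymp
      then have "s \<longlonglongrightarrow> z + of_real 0" unfolding s_def by (intro tendsto_intros)
      then show ?thesis by simp
    qed
    have inj: "inj s" using z by (auto simp: s_def inj_def)
    define f where "f n t = (if N t then G (s n) t / bp_factor (\<tau> t) (s n) else 0)" for n t
    show "f n \<in> borel_measurable M" for n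
    proof -
      have [measurable]: "G (s n) \<in> borel_measurable M" "\<tau> \<in> borel_measurable M"
        using meas[OF sD] \<tau>meas by auto
      have [measurable]: "(\<lambda>t. cnj (\<tau> t)) \<in> borel_measurable M"
        by (rule borel_measurable_continuous_on[OF _ \<tau>meas]) (intro continuous_intros)
      show ?thesis unfolding f_def bp_factor_def by (rule measurable_If[OF _ _ Nset]) measurable
    qed
    show "(\<lambda>n. f n t) \<longlonglongrightarrow> p z t" if "t \<in> space M" for t
    proof (cases "N t")
      case True
      have "isCont (q t) z" using q(1)[OF True] z holomorphic_on_imp_continuous_on
        by (metis continuous_on_eq_continuous_at open_ball)
      then have "(\<lambda>n. q t (s n)) \<longlonglongrightarrow> q t z" by (rule isCont_tendsto_compose[OF _ slim])
      moreover have "eventually (\<lambda>n. q t (s n) = f n t) sequentially"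
      proof -
        have "finite (s -` {\<tau> t})" by (rule finite_vimageI[OF _ inj]) simp
        then have "eventually (\<lambda>n. n \<notin> s -` {\<tau> t}) sequentially"
          unfolding cofinite_eq_sequentially[symmetric] eventually_cofinite by (simp add: vimage_def)
        then show ?thesis
        proof eventually_elim
          case (elim n)
          have "norm (\<tau> t) \<le> 1" "norm (s n) < 1" using \<tau>N[OF True] sD[of n] by auto
          moreover have "s n \<noteq> \<tau> t" using elim by simp
          ultimately have "bp_factor (\<tau> t) (s n) \<noteq> 0" by (simp add: bp_factor_eq_0_iff)
          moreover have "f n t = G (s n) t / bp_factor (\<tau> t) (s n)" using True by (simp add: f_def)
          ultimately show ?case unfolding q(3)[OF True sD] by simp
        qed
      qed
      ultimately have "(\<lambda>n. f n t) \<longlonglongrightarrow> q t z" by (rule Lim_transform_eventually)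
      then show ?thesis using True by (simp add: p_def)
    qed (simp add: f_def p_def)
  qed
  show ?thesis
  proof (rule that[OF \<tau>meas _ pmeas])
    show "\<tau> t \<in> cball 0 1" for t using \<tau>N[of t] by (cases "N t") (auto simp: \<tau>_def)
    show "(\<lambda>z. p z t) holomorphic_on unit_disc" for t
      using q(1)[of t] by (cases "N t") (auto simp: p_def)
    show "Re (p z t) \<ge> 0" if "z \<in> unit_disc" for z t using q(2)[of t z] that by (simp add: p_def)
    show "G z t = bp_factor (\<tau> t) z * p z t"
      if "t \<in> space M" "\<exists>\<sigma>\<in>cball 0 1. bp_point (\<lambda>z. G z t) \<sigma>" "z \<in> unit_disc" for t z
      using q(3)[of t z] that by (cases "N t") (auto simp: p_def N_def)
  qed
qed

section \<open>Exceptional null sets and the order of integrability\<close>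

text \<open>The null sets that belong to a countable dense set of \<open>z\<close> together form a null set, and
continuity in \<open>z\<close> extends the bound to all \<open>z\<close>. This makes the exceptional set independent
of \<open>z\<close>.\<close>

lemma AE_norm_le_everywhere:
  fixes H :: "'b::{metric_space, second_countable_topology} \<Rightarrow> 'a \<Rightarrow> 'c::real_normed_vector"
  assumes AE: "\<And>z. z \<in> S \<Longrightarrow> AE t in M. norm (H z t) \<le> k t"
    and cont: "\<And>t. t \<in> space M \<Longrightarrow> continuous_on S (\<lambda>z. H z t)"
  shows "AE t in M. \<forall>z\<in>S. norm (H z t) \<le> k t"
proof -
  obtain Z where Z: "countable Z" "Z \<subseteq> S" "S \<subseteq> closure Z"
    by (rule separable)
  have "AE t in M. \<forall>z\<in>Z. norm (H z t) \<le> k t"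
    unfolding AE_ball_countable[OF Z(1)] using AE Z(2) by blast
  then show ?thesis
  proof (rule AE_mp, intro AE_I2 impI ballI)
    fix t z assume t: "t \<in> space M" and le: "\<forall>z\<in>Z. norm (H z t) \<le> k t" and z: "z \<in> S"
    have "continuous_on S (\<lambda>z. k t - norm (H z t))" by (intro continuous_intros cont t)
    from nonneg_if_nonneg_on_dense[OF this Z(3,2) _ z] show "norm (H z t) \<le> k t" using le by simp
  qed
qed

lemma AE_eq_everywhere:
  fixes f g :: "'b::{metric_space, second_countable_topology} \<Rightarrow> 'a \<Rightarrow> 'c::real_normed_vector"
  assumes "\<And>z. z \<in> S \<Longrightarrow> AE t in M. f z t = g z t"
    and "\<And>t. t \<in> space M \<Longrightarrow> continuous_on S (\<lambda>z. f z t)"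
    and "\<And>t. t \<in> space M \<Longrightarrow> continuous_on S (\<lambda>z. g z t)"
  shows "AE t in M. \<forall>z\<in>S. f z t = g z t"
proof -
  have "AE t in M. \<forall>z\<in>S. norm (f z t - g z t) \<le> 0"
    by (rule AE_norm_le_everywhere) (use assms in \<open>auto intro!: continuous_intros\<close>)
  then show ?thesis by simp
qed

text \<open>The factor has at most the zero \<open>\<tau>\<close>, and there \<open>h\<close> is determined by continuity.\<close>

lemma bp_factor_cancel:
  assumes cont: "continuous_on unit_disc h" and \<tau>: "\<tau> \<in> cball 0 1"
    and 0: "\<And>z. z \<in> unit_disc \<Longrightarrow> bp_factor \<tau> z * h z = 0" and z: "z \<in> unit_disc"
  shows "h z = 0"
proof (cases "z = \<tau>")
  case False
  then show ?thesis using 0[OF z] bp_factor_eq_0_iff[of \<tau> z] \<tau> z by simp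
next
  case True
  have "isCont h \<tau>" using cont z True by (simp add: continuous_on_eq_continuous_at)
  then have "(h \<longlongrightarrow> h \<tau>) (at \<tau>)" by (simp add: isCont_def)
  moreover have "eventually (\<lambda>w. w \<in> unit_disc - {\<tau>}) (at \<tau>)"
    using z True by (intro eventually_at_in_open) auto
  then have "eventually (\<lambda>w. h w = 0) (at \<tau>)"
  proof eventually_elim
    case (elim w)
    then show ?case using 0[of w] bp_factor_eq_0_iff[of \<tau> w] \<tau> by simp
  qed
  then have "(h \<longlongrightarrow> 0) (at \<tau>)" by (rule tendsto_eventually)
  ultimately show ?thesis using True tendsto_unique[of "at \<tau>" h] by simp
qed

text \<open>If \<open>|\<tau>| \<ge> 1/2\<close>, the factor at \<open>0\<close>, which is \<open>\<tau>\<close>, is large enough. Otherwise the factor is at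
least \<open>1/8\<close> on the circle of radius \<open>3/4\<close>, and the maximum principle bounds \<open>p 0\<close>. The point
is that the constants do not depend on \<open>\<tau>\<close>.\<close>

lemma norm_factor_at_0_le:
  assumes hol: "p holomorphic_on unit_disc" and \<tau>: "\<tau> \<in> cball 0 1"
    and le: "\<And>z. z \<in> cball 0 (3/4) \<Longrightarrow> norm (bp_factor \<tau> z * p z) \<le> k"
  shows "norm (p 0) \<le> 8 * k"
proof (cases "norm \<tau> < 1/2")
  case False
  then have "1/2 * norm (p 0) \<le> norm \<tau> * norm (p 0)" by (intro mult_right_mono) auto
  also have "\<dots> \<le> k" using le[of 0] by (simp add: bp_factor_def norm_mult)
  finally show ?thesis using norm_ge_zero[of "p 0"] by linarith
next
  case True
  have sub: "cball 0 (3/4) \<subseteq> unit_disc" by auto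
  show ?thesis
  proof (rule maximum_modulus_frontier[of p "ball 0 (3/4)"])
    show "p holomorphic_on interior (ball 0 (3/4))"
      using holomorphic_on_subset[OF hol, of "ball 0 (3/4)"] by (simp add: subset_ball)
    show "continuous_on (closure (ball 0 (3/4))) p"
      using continuous_on_subset[OF holomorphic_on_imp_continuous_on[OF hol] sub] by simp
    show "norm (p z) \<le> 8 * k" if "z \<in> frontier (ball 0 (3/4))" for z
    proof -
      have z: "norm z = 3/4" using that by simp
      have 1: "1/4 \<le> norm (z - \<tau>)" using norm_triangle_ineq2[of z \<tau>] True z by linarith
      have "norm (cnj \<tau> * z) \<le> 1/2 * (3/4)"
        using True z unfolding norm_mult by (intro mult_mono) auto
      then have 2: "1/2 \<le> norm (cnj \<tau> * z - 1)"
        using norm_triangle_ineq2[of 1 "cnj \<tau> * z"] by (simp add: norm_minus_commute)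
      have "1/4 * (1/2) \<le> norm (z - \<tau>) * norm (cnj \<tau> * z - 1)"
        using 1 2 by (intro mult_mono) auto
      then have "1/8 * norm (p z) \<le> norm (bp_factor \<tau> z) * norm (p z)"
        by (intro mult_right_mono) (auto simp: bp_factor_def norm_mult)
      also have "\<dots> \<le> k" using le[of z] z by (simp add: norm_mult)
      finally show ?thesis by simp
    qed
  qed auto
qed

lemma AE_lebesgue_on_subset:
  assumes "AE t in lebesgue_on S. P t" "K \<subseteq> S" "S \<in> sets lebesgue" "K \<in> sets lebesgue"
  shows "AE t in lebesgue_on K. P t"
proof -
  have "AE t in lebesgue. t \<in> S \<longrightarrow> P t"
    using assms(1,3) by (simp add: AE_restrict_space_iff)
  then have "AE t in lebesgue. t \<in> K \<longrightarrow> P t"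
    by eventually_elim (use assms(2) in auto)
  then show ?thesis using assms(4) by (simp add: AE_restrict_space_iff)
qed

lemma in_L_dominated:
  fixes f :: "real \<Rightarrow> 'a::real_normed_vector" and k :: "real \<Rightarrow> 'b::real_normed_vector"
  assumes k: "in_L d S k" and sets: "S \<in> sets lebesgue" "K \<in> sets lebesgue" "K \<subseteq> S"
    and f: "f \<in> borel_measurable (lebesgue_on K)" and c: "c \<ge> 0"
    and le: "AE t in lebesgue_on K. norm (f t) \<le> c * norm (k t)"
  shows "in_L d K f"
proof (cases "d = \<infinity>")
  case True
  then obtain C where "AE t in lebesgue_on S. norm (k t) \<le> C"
    using k by (auto simp: in_L_def)
  then have "AE t in lebesgue_on K. norm (k t) \<le> C"
    by (rule AE_lebesgue_on_subset) (use sets in auto)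
  then have "AE t in lebesgue_on K. norm (f t) \<le> c * C"
    using le by eventually_elim (use c mult_left_mono order_trans in blast)
  then show ?thesis using True f by (auto simp: in_L_def)
next
  case False
  define e where "e = enn2real d"
  have e: "e \<ge> 0" by (simp add: e_def)
  have "integrable (lebesgue_on S) (\<lambda>t. norm (k t) powr e)"
    using k False by (simp add: in_L_def e_def)
  then have "integrable lebesgue (\<lambda>t. indicator S t *\<^sub>R (norm (k t) powr e))"
    using sets(1) by (simp add: integrable_restrict_space)
  then have "integrable lebesgue (\<lambda>t. indicator K t *\<^sub>R (indicator S t *\<^sub>R (norm (k t) powr e)))"
    by (rule integrable_mult_indicator[OF sets(2)])
  moreover have "(\<lambda>t. indicator K t *\<^sub>R (indicator S t *\<^sub>R (norm (k t) powr e)))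
      = (\<lambda>t. indicator K t *\<^sub>R (norm (k t) powr e))"
    using sets(3) by (auto simp: fun_eq_iff indicator_def)
  ultimately have "integrable (lebesgue_on K) (\<lambda>t. norm (k t) powr e)"
    using sets(2) by (simp add: integrable_restrict_space)
  then have "integrable (lebesgue_on K) (\<lambda>t. c powr e * norm (k t) powr e)" by simp
  then have "integrable (lebesgue_on K) (\<lambda>t. norm (f t) powr e)"
  proof (rule Bochner_Integration.integrable_bound)
    show "(\<lambda>t. norm (f t) powr e) \<in> borel_measurable (lebesgue_on K)"
      using f by measurable
    show "AE t in lebesgue_on K. norm (norm (f t) powr e) \<le> norm (c powr e * norm (k t) powr e)"
      using le
    proof eventually_elim
      case (elim t)
      then have "norm (f t) powr e \<le> (c * norm (k t)) powr e" using e by (intro powr_mono2) auto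
      then show ?case using c by (simp add: powr_mult)
    qed
  qed
  then show ?thesis using f False by (simp add: in_L_def e_def)
qed

text \<open>Local integrability gives measurability on compact sets only; countably many of them cover the
half-line.\<close>

lemma in_L_loc_imp_measurable:
  assumes "in_L_loc d {0..} f"
  shows "f \<in> borel_measurable (lebesgue_on {0..})"
proof (rule measurable_piecewise_restrict[of "range (\<lambda>n. {0..real n})"])
  have sub: "{0..} \<inter> {0..real n} = {0..real n}" for n by auto
  fix \<Omega> assume "\<Omega> \<in> range (\<lambda>n. {0..real n})"
  then obtain n where \<Omega>: "\<Omega> = {0..real n}" by auto
  have "f \<in> borel_measurable (lebesgue_on {0..real n})"
    using assms by (auto simp: in_L_loc_def in_L_def)
  then show "f \<in> borel_measurable (restrict_space (lebesgue_on {0..}) \<Omega>)"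
    unfolding \<Omega> by (subst restrict_restrict_space) (auto simp: sub)
  show "\<Omega> \<inter> space (lebesgue_on {0..}) \<in> sets (lebesgue_on {0..})"
    unfolding \<Omega> by (subst sets_restrict_space_iff) auto
next
  show "space (lebesgue_on {0..}) \<subseteq> \<Union> (range (\<lambda>n. {0..real n}))"
  proof
    fix x :: real assume x: "x \<in> space (lebesgue_on {0..})"
    obtain n :: nat where "x \<le> real n" using real_arch_simple by blast
    then have "x \<in> {0..real n}" using x by simp
    then show "x \<in> \<Union> (range (\<lambda>n. {0..real n}))" by blast
  qed
qed simp

lemma compact_subset_interval:
  fixes K :: "real set"
  assumes "compact K" "K \<subseteq> {0..}"
  obtains T where "T > 0" "K \<subseteq> {0..T}"
proof -
  obtain B where B: "B > 0" "\<And>x. x \<in> K \<Longrightarrow> norm x \<le> B"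
    using compact_imp_bounded[OF assms(1)] unfolding bounded_pos by blast
  have "x \<in> {0..B}" if "x \<in> K" for x
    using B(2)[OF that] assms(2) that by auto
  then show ?thesis using that[of B] B(1) by blast
qed

section \<open>Herglotz vector fields\<close>

text \<open>\<open>|p z t|\<close> is bounded through Harnack's inequality by \<open>|p 0 t|\<close>, and this by the majorant \<open>k t\<close>
of \<open>G\<close> on the disc of radius \<open>3/4\<close>, which has the required order of integrability.\<close>

lemma herglotz_vector_field_factorization:
  assumes G: "herglotz_vector_field d G"
  obtains \<tau> p where "measurable_to_closed_disc \<tau>" "herglotz_function d p"
    "AE t in lebesgue_on {0..}. \<forall>z\<in>unit_disc. G z t = berkson_porta \<tau> p z t"
proof -
  have meas: "\<And>z. z \<in> unit_disc \<Longrightarrow> G z \<in> borel_measurable (lebesgue_on {0..})"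
    and hol: "\<And>t. t \<in> space (lebesgue_on {0..}) \<Longrightarrow> (\<lambda>z. G z t) holomorphic_on unit_disc"
    and bound: "\<And>K T. compact K \<Longrightarrow> K \<subseteq> unit_disc \<Longrightarrow> T > 0 \<Longrightarrow>
      \<exists>k::real \<Rightarrow> real. in_L d {0..T} k \<and> (\<forall>t\<in>{0..T}. k t \<ge> 0) \<and>
           (\<forall>z\<in>K. AE t in lebesgue_on {0..T}. norm (G z t) \<le> k t)"
    and gen: "AE t in lebesgue_on {0..}. (\<lambda>z. G z t) \<in> Gen"
    using G by (auto simp: herglotz_vector_field_def weak_holomorphic_vector_field_def)
  obtain \<tau> p where \<tau>: "\<tau> \<in> borel_measurable (lebesgue_on {0..})" "\<And>t. \<tau> t \<in> cball 0 1"
    and p: "\<And>z. z \<in> unit_disc \<Longrightarrow> p z \<in> borel_measurable (lebesgue_on {0..})"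
      "\<And>t. (\<lambda>z. p z t) holomorphic_on unit_disc" "\<And>z t. z \<in> unit_disc \<Longrightarrow> Re (p z t) \<ge> 0"
    and fac: "\<And>t z. t \<in> space (lebesgue_on {0..}) \<Longrightarrow> \<exists>\<sigma>\<in>cball 0 1. bp_point (\<lambda>z. G z t) \<sigma> \<Longrightarrow>
        z \<in> unit_disc \<Longrightarrow> G z t = bp_factor (\<tau> t) z * p z t"
    using measurable_factorization[OF meas hol] by blast
  have eq: "AE t in lebesgue_on {0..}. \<forall>z\<in>unit_disc. G z t = bp_factor (\<tau> t) z * p z t"
    using gen
  proof (rule AE_mp, intro AE_I2 impI ballI)
    fix t z assume t: "t \<in> space (lebesgue_on {0..})" and F: "(\<lambda>z. G z t) \<in> Gen" and z: "z \<in> unit_disc"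
    show "G z t = bp_factor (\<tau> t) z * p z t"
      by (rule fac[OF t bp_point_exists[OF hol[OF t] Gen_imp_inward_pointing[OF F]] z])
  qed
  have "in_L_loc d {0..} (p z)" if z: "z \<in> unit_disc" for z
    unfolding in_L_loc_def
  proof (intro allI impI)
    fix K :: "real set" assume K: "compact K \<and> K \<subseteq> {0..}"
    then obtain T where T: "T > 0" "K \<subseteq> {0..T}" using compact_subset_interval by blast
    have Ks: "K \<in> sets lebesgue" using K lmeasurable_compact fmeasurableD by blast
    obtain k :: "real \<Rightarrow> real" where k: "in_L d {0..T} k"
      "\<forall>w\<in>cball 0 (3/4). AE t in lebesgue_on {0..T}. norm (G w t) \<le> k t"
    proof -
      have "cball 0 (3/4) \<subseteq> unit_disc" by auto
      from bound[OF compact_cball this T(1)] show ?thesis using that by blast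
    qed
    have "AE t in lebesgue_on {0..T}. \<forall>w\<in>cball 0 (3/4). norm (G w t) \<le> k t"
    proof (rule AE_norm_le_everywhere)
      show "continuous_on (cball 0 (3/4)) (\<lambda>z. G z t)" if "t \<in> space (lebesgue_on {0..T})" for t
        by (rule continuous_on_subset[OF holomorphic_on_imp_continuous_on[OF hol]]) (use that in auto)
    qed (use k(2) in auto)
    then have 1: "AE t in lebesgue_on K. \<forall>w\<in>cball 0 (3/4). norm (G w t) \<le> k t"
      by (rule AE_lebesgue_on_subset) (use T Ks in auto)
    have 2: "AE t in lebesgue_on K. \<forall>z\<in>unit_disc. G z t = bp_factor (\<tau> t) z * p z t"
      by (rule AE_lebesgue_on_subset[OF eq]) (use K Ks in auto)
    define c where "c = (1 + norm z) / (1 - norm z) * 8"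
    have c: "c \<ge> 0" using z by (simp add: c_def)
    show "in_L d K (p z)"
    proof (rule in_L_dominated[OF k(1) _ Ks T(2) _ c])
      show "p z \<in> borel_measurable (lebesgue_on K)"
        by (rule measurable_restrict_mono[OF p(1)[OF z]]) (use K in auto)
      show "AE t in lebesgue_on K. norm (p z t) \<le> c * norm (k t)"
        using 1 2
      proof eventually_elim
        case (elim t)
        have "norm (p 0 t) \<le> 8 * k t"
        proof (rule norm_factor_at_0_le[OF p(2) \<tau>(2)])
          fix w :: complex assume w: "w \<in> cball 0 (3/4)"
          then have "w \<in> unit_disc" by auto
          then show "norm (bp_factor (\<tau> t) w * p w t) \<le> k t" using elim w by metis
        qed
        also have "\<dots> \<le> 8 * norm (k t)" by simp
        finally have p0: "norm (p 0 t) \<le> 8 * norm (k t)" .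
        have "norm (p z t) * (1 - norm z) \<le> (1 + norm z) * norm (p 0 t)"
          by (rule Harnack_norm_le[OF p(2,3)]) (use z in auto)
        also have "\<dots> \<le> (1 + norm z) * (8 * norm (k t))" using p0 by (intro mult_left_mono) auto
        finally show ?case using z by (simp add: c_def field_simps)
      qed
    qed simp
  qed
  then have "herglotz_function d p" using p by (simp add: herglotz_function_def)
  moreover have "measurable_to_closed_disc \<tau>" using \<tau> by (simp add: measurable_to_closed_disc_def)
  moreover have "AE t in lebesgue_on {0..}. \<forall>z\<in>unit_disc. G z t = berkson_porta \<tau> p z t"
    using eq by (simp add: berkson_porta_def bp_factor_def)
  ultimately show ?thesis using that by blast
qed

text \<open>A common Berkson-Porta point can be cancelled. If the product vanishes identically, both
cofactors do, whatever the two points are.\<close>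

lemma factorization_unique:
  assumes p: "p holomorphic_on unit_disc" "\<And>z. z \<in> unit_disc \<Longrightarrow> Re (p z) \<ge> 0"
    and q: "q holomorphic_on unit_disc" "\<And>z. z \<in> unit_disc \<Longrightarrow> Re (q z) \<ge> 0"
    and \<tau>: "\<tau> \<in> cball 0 1" and \<sigma>: "\<sigma> \<in> cball 0 1"
    and eq: "\<And>z. z \<in> unit_disc \<Longrightarrow> bp_factor \<tau> z * p z = bp_factor \<sigma> z * q z"
  shows "\<And>z. z \<in> unit_disc \<Longrightarrow> p z = q z"
    and "\<exists>z\<in>unit_disc. bp_factor \<tau> z * p z \<noteq> 0 \<Longrightarrow> \<tau> = \<sigma>"
proof -
  define F where "F z = bp_factor \<tau> z * p z" for z
  have hol: "F holomorphic_on unit_disc"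
    unfolding F_def bp_factor_def using p(1) by (intro holomorphic_intros)
  have bp: "bp_point F \<tau>" "bp_point F \<sigma>"
    using factorization_imp_bp_point[OF p(2), where F = F and \<tau> = \<tau>]
      factorization_imp_bp_point[OF q(2), where F = F and \<tau> = \<sigma>] eq
    by (auto simp: F_def)
  have cont: "continuous_on unit_disc p" "continuous_on unit_disc q"
    using p(1) q(1) holomorphic_on_imp_continuous_on by auto
  show \<tau>\<sigma>: "\<tau> = \<sigma>" if "\<exists>z\<in>unit_disc. bp_factor \<tau> z * p z \<noteq> 0"
    by (rule bp_point_unique[OF hol _ bp \<tau> \<sigma>]) (use that in \<open>simp add: F_def\<close>)
  fix z :: complex assume z: "z \<in> unit_disc"
  show "p z = q z"
  proof (cases "\<exists>z\<in>unit_disc. bp_factor \<tau> z * p z \<noteq> 0")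
    case True
    have "(\<lambda>z. p z - q z) z = 0"
      by (rule bp_factor_cancel[OF _ \<tau> _ z])
         (use eq \<tau>\<sigma>[OF True] cont in \<open>auto intro!: continuous_intros simp: algebra_simps\<close>)
    then show ?thesis by simp
  next
    case False
    have "p z = 0" by (rule bp_factor_cancel[OF cont(1) \<tau> _ z]) (use False in auto)
    moreover have "q z = 0" by (rule bp_factor_cancel[OF cont(2) \<sigma> _ z]) (use False eq in auto)
    ultimately show ?thesis by simp
  qed
qed

lemma berkson_porta_unique:
  assumes "measurable_to_closed_disc \<tau>" "herglotz_function d p"
    and "measurable_to_closed_disc \<tau>'" "herglotz_function d p'"
    and hol: "\<And>t. t \<ge> 0 \<Longrightarrow> (\<lambda>z. G z t) holomorphic_on unit_disc"
    and 1: "AE t in lebesgue_on {0..}. \<forall>z\<in>unit_disc. G z t = berkson_porta \<tau> p z t"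
    and AE: "\<And>z. z \<in> unit_disc \<Longrightarrow> AE t in lebesgue_on {0..}. G z t = berkson_porta \<tau>' p' z t"
  shows "AE t in lebesgue_on {0..}. \<forall>z\<in>unit_disc. p z t = p' z t"
    and "AE t in lebesgue_on {0..}. (\<exists>z\<in>unit_disc. G z t \<noteq> 0) \<longrightarrow> \<tau> t = \<tau>' t"
proof -
  have 2: "AE t in lebesgue_on {0..}. \<forall>z\<in>unit_disc. G z t = berkson_porta \<tau>' p' z t"
  proof (rule AE_eq_everywhere[OF AE])
    fix t :: real assume "t \<in> space (lebesgue_on {0..})"
    then have t: "t \<ge> 0" by simp
    then have "(\<lambda>z. p' z t) holomorphic_on unit_disc" using assms(4) by (simp add: herglotz_function_def)
    then have "(\<lambda>z. berkson_porta \<tau>' p' z t) holomorphic_on unit_disc"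
      unfolding berkson_porta_def by (intro holomorphic_intros)
    then show "continuous_on unit_disc (\<lambda>z. berkson_porta \<tau>' p' z t)"
      by (rule holomorphic_on_imp_continuous_on)
    show "continuous_on unit_disc (\<lambda>z. G z t)"
      by (rule holomorphic_on_imp_continuous_on[OF hol[OF t]])
  qed
  have "AE t in lebesgue_on {0..}. (\<forall>z\<in>unit_disc. p z t = p' z t) \<and>
      ((\<exists>z\<in>unit_disc. G z t \<noteq> 0) \<longrightarrow> \<tau> t = \<tau>' t)"
    using 1 2 AE_space
  proof eventually_elim
    case (elim t)
    then have t: "t \<ge> 0" by simp
    have p: "(\<lambda>z. p z t) holomorphic_on unit_disc" "\<And>z. z \<in> unit_disc \<Longrightarrow> Re (p z t) \<ge> 0"
      and p': "(\<lambda>z. p' z t) holomorphic_on unit_disc" "\<And>z. z \<in> unit_disc \<Longrightarrow> Re (p' z t) \<ge> 0"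
      using assms(2,4) t by (auto simp: herglotz_function_def)
    have \<tau>: "\<tau> t \<in> cball 0 1" "\<tau>' t \<in> cball 0 1"
      using assms(1,3) t unfolding measurable_to_closed_disc_def by (simp_all add: Pi_iff)
    have G: "G z t = bp_factor (\<tau> t) z * p z t" "G z t = bp_factor (\<tau>' t) z * p' z t"
      if "z \<in> unit_disc" for z
      using elim that by (simp_all add: berkson_porta_def bp_factor_def)
    then have eq: "bp_factor (\<tau> t) z * p z t = bp_factor (\<tau>' t) z * p' z t" if "z \<in> unit_disc" for z
      using that by metis
    show ?case
      using factorization_unique[OF p p' \<tau> eq] G(1) by auto
  qed
  then show "AE t in lebesgue_on {0..}. \<forall>z\<in>unit_disc. p z t = p' z t"
    and "AE t in lebesgue_on {0..}. (\<exists>z\<in>unit_disc. G z t \<noteq> 0) \<longrightarrow> \<tau> t = \<tau>' t"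
    by (auto elim: AE_mp)
qed

text \<open>A majorant on a compact set \<open>K\<close> is a multiple of \<open>|p 0 t|\<close>, by Harnack's inequality.\<close>

lemma herglotz_vector_field_berkson_porta:
  assumes \<tau>: "measurable_to_closed_disc \<tau>" and p: "herglotz_function d p"
  shows "herglotz_vector_field d (berkson_porta \<tau> p)"
proof -
  have pmeas: "p z \<in> borel_measurable (lebesgue_on {0..})" if "z \<in> unit_disc" for z
    using p that by (auto simp: herglotz_function_def intro: in_L_loc_imp_measurable)
  have phol: "(\<lambda>z. p z t) holomorphic_on unit_disc" and ppos: "\<And>z. z \<in> unit_disc \<Longrightarrow> Re (p z t) \<ge> 0"
    if "t \<ge> 0" for t
    using p that by (auto simp: herglotz_function_def)
  have \<tau>D: "\<tau> t \<in> cball 0 1" if "t \<ge> 0" for t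
    using \<tau> that unfolding measurable_to_closed_disc_def by (simp add: Pi_iff)
  have Ghol: "(\<lambda>z. berkson_porta \<tau> p z t) holomorphic_on unit_disc" if "t \<ge> 0" for t
    unfolding berkson_porta_def using phol[OF that] by (intro holomorphic_intros)
  have "(\<lambda>z. berkson_porta \<tau> p z t) \<in> Gen" if t: "t \<ge> 0" for t
  proof (rule inward_pointing_imp_Gen[OF Ghol[OF t]])
    show "inward_pointing (\<lambda>z. berkson_porta \<tau> p z t)"
      by (rule factorization_imp_inward_pointing[OF phol[OF t] ppos[OF t], where \<tau> = "\<tau> t"])
         (simp_all add: berkson_porta_def bp_factor_def)
  qed
  then have "AE t in lebesgue_on {0..}. (\<lambda>z. berkson_porta \<tau> p z t) \<in> Gen"
    by (intro AE_I2) simp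
  moreover have "weak_holomorphic_vector_field d (berkson_porta \<tau> p)"
    unfolding weak_holomorphic_vector_field_def
  proof (intro conjI ballI allI impI)
    show "berkson_porta \<tau> p z \<in> borel_measurable (lebesgue_on {0..})" if z: "z \<in> unit_disc" for z
    proof -
      have [measurable]: "\<tau> \<in> borel_measurable (lebesgue_on {0..})" "p z \<in> borel_measurable (lebesgue_on {0..})"
        using \<tau> pmeas[OF z] by (auto simp: measurable_to_closed_disc_def)
      have [measurable]: "(\<lambda>t. cnj (\<tau> t)) \<in> borel_measurable (lebesgue_on {0..})"
        by (rule borel_measurable_continuous_on[of cnj]) (auto intro: continuous_intros)
      show ?thesis unfolding berkson_porta_def by measurable
    qed
    show "(\<lambda>z. berkson_porta \<tau> p z t) holomorphic_on unit_disc" if "0 \<le> t" for t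
      by (rule Ghol[OF that])
    fix K :: "complex set" and T :: real
    assume KT: "compact K \<and> K \<subseteq> unit_disc \<and> 0 < T"
    obtain r where r: "0 \<le> r" "r < 1" "K \<subseteq> cball 0 r"
      using compact_subset_disc KT by metis
    define c where "c = 4 * ((1 + r) / (1 - r))"
    have c: "c \<ge> 0" using r by (simp add: c_def)
    have p0: "in_L d {0..T} (p 0)"
      using p by (auto simp: herglotz_function_def in_L_loc_def)
    have le: "norm (berkson_porta \<tau> p z t) \<le> c * norm (p 0 t)" if z: "z \<in> K" and t: "t \<in> {0..T}" for z t
    proof -
      have zr: "norm z \<le> r" and zD: "z \<in> unit_disc" using z r KT by auto
      have "norm (bp_factor (\<tau> t) z) \<le> 4"
        using norm_bp_factor_le[of "\<tau> t" z] \<tau>D[of t] t zD by simp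
      then have "norm (bp_factor (\<tau> t) z * p z t) \<le> 4 * norm (p z t)"
        unfolding norm_mult by (intro mult_right_mono) auto
      moreover have "norm (p z t) \<le> (1 + r) / (1 - r) * norm (p 0 t)"
        using Harnack_norm_le[OF phol ppos zr r(2), of t] t r(2) by (simp add: field_simps)
      ultimately have "norm (bp_factor (\<tau> t) z * p z t) \<le> 4 * ((1 + r) / (1 - r) * norm (p 0 t))"
        by linarith
      then show ?thesis by (simp only: c_def berkson_porta_def bp_factor_def mult.assoc)
    qed
    show "\<exists>k::real \<Rightarrow> real. in_L d {0..T} k \<and> (\<forall>t\<in>{0..T}. 0 \<le> k t) \<and>
        (\<forall>z\<in>K. AE t in lebesgue_on {0..T}. norm (berkson_porta \<tau> p z t) \<le> k t)"
    proof (intro exI[of _ "\<lambda>t. c * norm (p 0 t)"] conjI ballI)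
      have "p 0 \<in> borel_measurable (lebesgue_on {0..T})" using p0 by (simp add: in_L_def)
      then show "in_L d {0..T} (\<lambda>t. c * norm (p 0 t))"
        by (intro in_L_dominated[OF p0 _ _ _ _ c]) (use c in auto)
      show "AE t in lebesgue_on {0..T}. norm (berkson_porta \<tau> p z t) \<le> c * norm (p 0 t)" if "z \<in> K" for z
        using le[OF that] by (intro AE_I2) simp
    qed (use c in auto)
  qed
  ultimately show ?thesis by (simp add: herglotz_vector_field_def)
qed

theorem theorem1p2:
  fixes d :: ennreal
  assumes "1 \<le> d"
  shows
    "(\<forall>G. herglotz_vector_field d G \<longrightarrow>
        (\<exists>\<tau> p. measurable_to_closed_disc \<tau> \<and> herglotz_function d p \<and>
           (\<forall>z\<in>unit_disc. AE t in lebesgue_on {0..}. G z t = berkson_porta \<tau> p z t) \<and>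
           (\<forall>\<tau>' p'. measurable_to_closed_disc \<tau>' \<and> herglotz_function d p' \<and>
              (\<forall>z\<in>unit_disc. AE t in lebesgue_on {0..}. G z t = berkson_porta \<tau>' p' z t) \<longrightarrow>
              (AE t in lebesgue_on {0..}. \<forall>z\<in>unit_disc. p z t = p' z t) \<and>
              (AE t in lebesgue_on {0..}. (\<exists>z\<in>unit_disc. G z t \<noteq> 0) \<longrightarrow> \<tau> t = \<tau>' t)))) \<and>
     (\<forall>\<tau> p. measurable_to_closed_disc \<tau> \<and> herglotz_function d p \<longrightarrow>
        herglotz_vector_field d (berkson_porta \<tau> p))"
proof (intro conjI allI impI)
  fix G assume G: "herglotz_vector_field d G"
  then have hol: "(\<lambda>z. G z t) holomorphic_on unit_disc" if "t \<ge> 0" for t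
    using that by (simp add: herglotz_vector_field_def weak_holomorphic_vector_field_def)
  obtain \<tau> p where \<tau>p: "measurable_to_closed_disc \<tau>" "herglotz_function d p"
    and eq: "AE t in lebesgue_on {0..}. \<forall>z\<in>unit_disc. G z t = berkson_porta \<tau> p z t"
    using herglotz_vector_field_factorization[OF G] .
  have "(AE t in lebesgue_on {0..}. \<forall>z\<in>unit_disc. p z t = p' z t) \<and>
      (AE t in lebesgue_on {0..}. (\<exists>z\<in>unit_disc. G z t \<noteq> 0) \<longrightarrow> \<tau> t = \<tau>' t)"
    if \<tau>p': "measurable_to_closed_disc \<tau>'" "herglotz_function d p'"
      and ae: "\<forall>z\<in>unit_disc. AE t in lebesgue_on {0..}. G z t = berkson_porta \<tau>' p' z t" for \<tau>' p'
    using berkson_porta_unique[OF \<tau>p \<tau>p' _ eq] hol ae by blast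
  moreover have "\<forall>z\<in>unit_disc. AE t in lebesgue_on {0..}. G z t = berkson_porta \<tau> p z t"
    using eq by (auto elim: AE_mp)
  ultimately show "\<exists>\<tau> p. measurable_to_closed_disc \<tau> \<and> herglotz_function d p \<and>
           (\<forall>z\<in>unit_disc. AE t in lebesgue_on {0..}. G z t = berkson_porta \<tau> p z t) \<and>
           (\<forall>\<tau>' p'. measurable_to_closed_disc \<tau>' \<and> herglotz_function d p' \<and>
              (\<forall>z\<in>unit_disc. AE t in lebesgue_on {0..}. G z t = berkson_porta \<tau>' p' z t) \<longrightarrow>
              (AE t in lebesgue_on {0..}. \<forall>z\<in>unit_disc. p z t = p' z t) \<and>
              (AE t in lebesgue_on {0..}. (\<exists>z\<in>unit_disc. G z t \<noteq> 0) \<longrightarrow> \<tau> t = \<tau>' t))"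
    using \<tau>p by blast
qed (use herglotz_vector_field_berkson_porta in blast)

end
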